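(* Let $\mathcal{L}$ be a finite, ranked, atomic lattice. For a building set $\mathcal{G}\subset\mathcal{L}$ define the rational function $$Z_{\mathcal{L}}^{\mathcal{G}}(s)=\sum_{U\in N(\mathcal{G})}\chi^{\circ}(U)\prod_{A\in U}\frac{1}{n_As+k_A}\in\mathbb{Q}(s),$$ where $n_A=|\{a\in A(\mathcal{L}): a\le A\}|$ is the number of atoms below $A$, $k_A=\mathrm{rk}(A)$, and $$\chi^{\circ}(U)=\sum_{S\in N(\mathcal{G}),\,S\supseteq U}(-1)^{|S|-|U|}\,\mathrm{rk}_{\mathbb{Z}}\,D(\mathcal{L},\mathcal{G},S).$$ Then $Z_{\mathcal{L}}^{\mathcal{G}}(s)$ is independent of the choice of building set $\mathcal{G}$: for any two building sets $\mathcal{G},\mathcal{G}'$ of $\mathcal{L}$, $Z_{\mathcal{L}}^{\mathcal{G}}(s)=Z_{\mathcal{L}}^{\mathcal{G}'}(s)$.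
   Context: All posets are finite. For a poset $\mathcal{L}$, $x\in\mathcal{L}$ and $S\subset\mathcal{L}$, write $S_{<x}=\{y\in S: y<x\}$ and similarly $S_{\le x}$; $\max S$ denotes the set of maximal elements of $S$; $\bigvee T$ is the join (least upper bound) of $T$. The least element is $\hat 0$; $[a,b]=\{x: a\le x\le b\}$; products of posets carry the componentwise order. The atoms of $\mathcal{L}$ are the elements covering $\hat 0$; $A(\mathcal{L})$ is the set of atoms. $\mathcal{L}$ is ranked if for each $x$ all maximal chains $\hat 0=x_0<x_1<\dots<x_r=x$ (each step a cover) have the same length $r=:\mathrm{rk}(x)$; it is atomic if every element is the join of a set of atoms. A subset $\mathcal{G}\subset\mathcal{L}\setminus\{\hat0\}$ is a building set if for every $p\in\mathcal{L}\setminus\{\hat 0\}$ there is a poset isomorphism $\phi:[\hat0,p]\to\prod_{g\in F_{\mathcal{G}}(p)}[\hat0,g]$ with $\phi(g)=(\hat0,\dots,g,\dots,\hat0)$ ($g$ in the $g$-th coordinate) for every $g\in F_{\mathcal{G}}(p)$, where $F_{\mathcal{G}}(p)=\max\{g\in\mathcal{G}:g\le p\}$. The nested set complex $N(\mathcal{G})$ is the set of all subsets $S\subset\mathcal{G}$ (including $\emptyset$) such that for every $T\subset S$ with $|T|\ge 2$ consisting of pairwise incomparable elements, $\bigvee T\notin\mathcal{G}$. For $S,H\subset\mathcal{L}$ and $B\in\mathcal{L}$ with $\bigvee(H\cup S_{<B})\le B$, let $d^S_{H,B}$ be the minimal number $m\ge 0$ of atoms $A_1,\dots,A_m$ such that $B=\bigvee\big(H\cup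 S_{<B}\cup\{A_1,\dots,A_m\}\big)$. For $I\in N(\mathcal{G})$ define $D(\mathcal{L},\mathcal{G},I)=\mathbb{Z}[\{x_g\}_{g\in\mathcal{G}}]/J_I$, where $J_I$ is the ideal generated by the polynomials $P^I_{H,B}=\prod_{A\in H}x_A\big(\sum_{C\in\mathcal{G},\,C\ge B}x_C\big)^{d^I_{H,B}}$, with $H$ running over all subsets of $\mathcal{G}$ and $B\in\mathcal{G}$ over all elements with $B>h$ for all $h\in H$. $\mathrm{rk}_{\mathbb{Z}}$ denotes the rank of a finitely generated abelian group. *)

theory Defs
  imports
    "HOL-Library.Poly_Mapping"
    "HOL-Library.FuncSet"
    "HOL-Computational_Algebra.Polynomial"
    "HOL-Computational_Algebra.Fraction_Field"
    "HOL-Algebra.QuotRing"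
begin

text \<open>
  A nonempty finite lattice has all joins, so finite lattices are exactly the types of sort
  \<open>{finite, complete_lattice}\<close>, with \<open>bot\<close> as least element and \<open>Sup\<close> as join.
\<close>

definition covers :: "('a::order \<times> 'a) set" where
  "covers = {(x, y). x < y \<and> \<not> (\<exists>z. x < z \<and> z < y)}"

text \<open>
  \<open>(bot, x) \<in> covers ^^ r\<close> says that there is a maximal chain of length \<open>r\<close> from \<open>bot\<close> to \<open>x\<close>.
\<close>

definition ranked :: "'a::{finite, order_bot} itself \<Rightarrow> bool" where
  "ranked _ \<longleftrightarrow> (\<forall>(x::'a) r r'. (bot, x) \<in> covers ^^ r \<longrightarrow> (bot, x) \<in> covers ^^ r' \<longrightarrow> r = r')"

definition rk :: "'a::{finite, order_bot} \<Rightarrow> nat" where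
  "rk x = (THE r. (bot, x) \<in> covers ^^ r)"

definition lattice_atoms :: "'a::order_bot set" where
  "lattice_atoms = {a. (bot, a) \<in> covers}"

definition atomic :: "'a::{finite, complete_lattice} itself \<Rightarrow> bool" where
  "atomic _ \<longleftrightarrow> (\<forall>x::'a. \<exists>T \<subseteq> lattice_atoms. x = Sup T)"

definition maximals :: "'a::order set \<Rightarrow> 'a set" where
  "maximals S = {x \<in> S. \<not> (\<exists>y\<in>S. x < y)}"

definition factors :: "'a::order set \<Rightarrow> 'a \<Rightarrow> 'a set" where
  "factors G p = maximals {g \<in> G. g \<le> p}"

text \<open>
  The product of the intervals \<open>{bot..g}\<close> is the set of extensional functions on the index set
  \<open>factors G p\<close>, ordered pointwise on that index set.
\<close>

definition building_set :: "'a::{finite, order_bot} set \<Rightarrow> bool" where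
  "building_set G \<longleftrightarrow> bot \<notin> G \<and>
     (\<forall>p. p \<noteq> bot \<longrightarrow>
       (\<exists>\<phi>. bij_betw \<phi> {bot..p} (\<Pi>\<^sub>E g\<in>factors G p. {bot..g}) \<and>
            (\<forall>x\<in>{bot..p}. \<forall>y\<in>{bot..p}. x \<le> y \<longleftrightarrow> (\<forall>g\<in>factors G p. \<phi> x g \<le> \<phi> y g)) \<and>
            (\<forall>g\<in>factors G p. \<phi> g = (\<lambda>h\<in>factors G p. if h = g then g else bot))))"

definition nested_sets :: "'a::{finite, complete_lattice} set \<Rightarrow> 'a set set" where
  "nested_sets G =
     {S. S \<subseteq> G \<and>
         (\<forall>T\<subseteq>S. card T \<ge> 2 \<longrightarrow> (\<forall>x\<in>T. \<forall>y\<in>T. x \<noteq> y \<longrightarrow> \<not> x \<le> y) \<longrightarrow> Sup T \<notin> G)}"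

type_synonym 'a zpoly = "('a \<Rightarrow>\<^sub>0 nat) \<Rightarrow>\<^sub>0 int"

definition var :: "'a \<Rightarrow> 'a zpoly" where
  "var g = Poly_Mapping.single (Poly_Mapping.single g 1) 1"

definition zpoly_ring :: "'a set \<Rightarrow> 'a zpoly ring" where
  "zpoly_ring G =
     \<lparr>carrier = {p. \<forall>m\<in>Poly_Mapping.keys p. Poly_Mapping.keys m \<subseteq> G},
      mult = (*), one = 1, zero = 0, add = (+)\<rparr>"

definition join_defect :: "'a::{finite, complete_lattice} set \<Rightarrow> 'a set \<Rightarrow> 'a \<Rightarrow> nat" where
  "join_defect S H B =
     (LEAST m. \<exists>X \<subseteq> lattice_atoms. card X = m \<and> B = Sup (H \<union> {y\<in>S. y < B} \<union> X))"

definition relation_poly ::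
    "'a::{finite, complete_lattice} set \<Rightarrow> 'a set \<Rightarrow> 'a set \<Rightarrow> 'a \<Rightarrow> 'a zpoly" where
  "relation_poly G I H B =
     (\<Prod>A\<in>H. var A) * (\<Sum>C\<in>{C\<in>G. B \<le> C}. var C) ^ join_defect I H B"

definition relation_ideal ::
    "'a::{finite, complete_lattice} set \<Rightarrow> 'a set \<Rightarrow> 'a zpoly set" where
  "relation_ideal G I =
     Idl\<^bsub>zpoly_ring G\<^esub> {relation_poly G I H B | H B. H \<subseteq> G \<and> B \<in> G \<and> (\<forall>h\<in>H. h < B)}"

definition D_ring :: "'a::{finite, complete_lattice} set \<Rightarrow> 'a set \<Rightarrow> 'a zpoly set ring" where
  "D_ring G I = zpoly_ring G Quot relation_ideal G I"

definition Z_independent :: "('b, 'm) ring_scheme \<Rightarrow> 'b set \<Rightarrow> bool" where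
  "Z_independent R X \<longleftrightarrow> finite X \<and> X \<subseteq> carrier R \<and>
     (\<forall>c::'b \<Rightarrow> int. (\<Oplus>\<^bsub>R\<^esub>x\<in>X. [c x] \<cdot>\<^bsub>R\<^esub> x) = \<zero>\<^bsub>R\<^esub> \<longrightarrow> (\<forall>x\<in>X. c x = 0))"

text \<open>
  The rank of the additive group of \<open>R\<close>. The maximum exists when that group is finitely generated.
\<close>

definition rank_Z :: "('b, 'm) ring_scheme \<Rightarrow> nat" where
  "rank_Z R = Max {card X | X. Z_independent R X}"

definition chi :: "'a::{finite, complete_lattice} set \<Rightarrow> 'a set \<Rightarrow> int" where
  "chi G U = (\<Sum>S\<in>{S \<in> nested_sets G. U \<subseteq> S}. (-1) ^ (card S - card U) * int (rank_Z (D_ring G S)))"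

definition num_atoms :: "'a::{finite, order_bot} \<Rightarrow> nat" where
  "num_atoms A = card {a \<in> lattice_atoms. a \<le> A}"

definition zeta :: "'a::{finite, complete_lattice} set \<Rightarrow> rat poly fract" where
  "zeta G = (\<Sum>U\<in>nested_sets G. of_int (chi G U) *
     (\<Prod>A\<in>U. 1 / Fract [:of_nat (rk A), of_nat (num_atoms A):] 1))"

end

theory Submission
  imports Defs
begin

text \<open>
  Write \<open>d(v, b)\<close> for the least number of atoms whose join with \<open>v\<close> is \<open>b\<close>, and \<open>d\<^sup>W(A)\<close> for
  \<open>d(v, A)\<close> where \<open>v\<close> is the join of the elements of \<open>W\<close> below \<open>A\<close>. Let \<open>w(A) = n\<^sub>A s + k\<^sub>A\<close>.

  Adjoining the variables of \<open>D(G, I)\<close> one at a time, from the top of \<open>G\<close> downwards, presents the ring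
  as an iterated extension \<open>R[x] / (x K, (x + u)\<^sup>d)\<close> with \<open>R/K\<close> the analogous ring
    for \<open>I \<union> {B}\<close>, where
  \<open>B\<close> is the element whose variable is adjoined. As \<open>u\<^sup>d\<close> kills \<open>K\<close>, this is free with basis the
  monomials \<open>m\<close> such that the exponent of every \<open>A \<in> G\<close> in \<open>m\<close> is less than \<open>d\<^sup>W(A)\<close>, where \<open>W\<close> is the
  union of \<open>I\<close> and the support of \<open>m\<close>. Inserting the resulting rank into the definition, the
  alternating sums collapse to the sum, over nested sets \<open>W\<close>, of the products over \<open>A \<in> W\<close> of
  \<open>d\<^sup>W(A) / w(A) - 1\<close>.

  Let \<open>h(x)\<close> be the part of this sum over the nested sets with join \<open>x\<close>. Then
  \<open>w(x) \<Sum>\<^sub>y h(y) = \<Sum>\<^sub>y h(y) d(y, x)\<close>, both sums over \<open>y \<le> x\<close>. For \<open>x \<in> G\<close> this follows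
    by pairing \<open>W\<close> with
  \<open>W \<union> {x}\<close>; for other \<open>x\<close> it follows from the factors of \<open>x\<close>, over which \<open>w\<close> and \<open>d\<close> are additive and
  the sums over nested sets are multiplicative. The equation determines \<open>h\<close> recursively and does not
  mention \<open>G\<close>.
\<close>

section \<open>Distances by atoms and nested sets\<close>

text \<open>\<open>join_defect S H B\<close> depends on \<open>H\<close> and \<open>S\<close> only
  through one join, so a distance between two elements suffices. It is meaningful for
  \<open>v \<le> b\<close>; otherwise no \<open>X\<close> qualifies and \<open>LEAST\<close> yields
  an unspecified number.\<close>

definition atom_dist :: "'a::{finite, complete_lattice} \<Rightarrow> 'a \<Rightarrow> nat" where
  "atom_dist v b = (LEAST m. \<exists>X \<subseteq> lattice_atoms. card X = m \<and> b = sup v (Sup X))"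

lemma join_defect_eq: "join_defect S H B = atom_dist (Sup (H \<union> {y\<in>S. y < B})) B"
  unfolding join_defect_def atom_dist_def by (simp add: Sup_union_distrib)

lemma atom_dist_le: "X \<subseteq> lattice_atoms \<Longrightarrow> b = sup v (Sup X) \<Longrightarrow> atom_dist v b \<le> card X"
  unfolding atom_dist_def by (rule Least_le) blast

lemma atom_dist_self [simp]: "atom_dist v v = 0"
  using atom_dist_le[of "{}" v v] by simp

lemma atom_dist_witness:
  assumes "atomic TYPE('a::{finite, complete_lattice})" and "(v::'a) \<le> b"
  shows "\<exists>X \<subseteq> lattice_atoms. card X = atom_dist v b \<and> b = sup v (Sup X)"
proof -
  obtain T where "T \<subseteq> lattice_atoms" "b = Sup T"
    using assms(1) unfolding atomic_def by blast
  then have "\<exists>m. \<exists>X \<subseteq> lattice_atoms. card X = m \<and> b = sup v (Sup X)"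
    using assms(2) by (metis sup.absorb2)
  then show ?thesis
    unfolding atom_dist_def by (rule LeastI_ex)
qed

lemma atom_dist_eq_0_iff:
  assumes "atomic TYPE('a::{finite, complete_lattice})" and "(v::'a) \<le> b"
  shows "atom_dist v b = 0 \<longleftrightarrow> v = b"
proof
  assume "atom_dist v b = 0"
  then obtain X where "card X = 0" "b = sup v (Sup X)"
    using atom_dist_witness[OF assms] by metis
  then show "v = b" by simp
qed simp

text \<open>Atoms leading from \<open>u\<close> to \<open>b\<close> also lead from \<open>v\<close>
  to the join of \<open>v\<close> and \<open>b\<close>. The join has its own name \<open>c\<close>
  so that the lemma applies to targets known to equal it.\<close>

lemma atom_dist_mono_sup:
  assumes "atomic TYPE('a::{finite, complete_lattice})" and "(u::'a) \<le> b" and "u \<le> v"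
    and "c = sup v b"
  shows "atom_dist v c \<le> atom_dist u b"
proof -
  obtain Y where Y: "Y \<subseteq> lattice_atoms" "card Y = atom_dist u b" "b = sup u (Sup Y)"
    using atom_dist_witness[OF assms(1,2)] by blast
  have "c = sup v (Sup Y)"
    unfolding assms(4) Y(3) using assms(3) by (metis sup.absorb1 sup.assoc)
  then show ?thesis using Y(1,2) atom_dist_le by metis
qed

text \<open>Atoms leading from \<open>u\<close> to \<open>b\<close> together with atoms leading from
  \<open>sup v b\<close> to \<open>c\<close> lead from \<open>v\<close> to \<open>c\<close>, because
  \<open>v\<close> lies above \<open>u\<close>.\<close>

lemma atom_dist_subadd:
  assumes at: "atomic TYPE('a::{finite, complete_lattice})"
    and "(u::'a) \<le> b" and "u \<le> v" and "b \<le> c" and "v \<le> c"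
  shows "atom_dist v c \<le> atom_dist (sup v b) c + atom_dist u b"
proof -
  obtain X where X: "X \<subseteq> lattice_atoms" "card X = atom_dist (sup v b) c" "c = sup (sup v b) (Sup X)"
    using atom_dist_witness[OF at, of "sup v b" c] assms by auto
  obtain Y where Y: "Y \<subseteq> lattice_atoms" "card Y = atom_dist u b" "b = sup u (Sup Y)"
    using atom_dist_witness[OF at assms(2)] by blast
  have "c = sup (sup v (sup u (Sup Y))) (Sup X)" using X(3) unfolding Y(3) .
  also have "\<dots> = sup v (Sup (X \<union> Y))"
  proof -
    have "sup v (sup u (Sup Y)) = sup v (Sup Y)"
      using assms(3) by (metis sup.absorb1 sup.assoc)
    then show ?thesis by (simp only: Sup_union_distrib sup.assoc sup.commute[of "Sup X"])
  qed
  finally have "atom_dist v c \<le> card (X \<union> Y)"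
    using X(1) Y(1) by (intro atom_dist_le) auto
  also have "\<dots> \<le> card X + card Y" by (rule card_Un_le)
  finally show ?thesis using X(2) Y(2) by simp
qed

section \<open>Nested sets in terms of joins of smaller elements\<close>

lemma Sup_lt_le: "Sup {y \<in> W. y < x} \<le> (x::'a::complete_lattice)"
  by (rule Sup_least) auto

lemma Sup_maximals:
  fixes S :: "'a::{finite, complete_lattice} set"
  shows "Sup (maximals S) = Sup S"
proof (rule antisym)
  show "Sup (maximals S) \<le> Sup S" by (rule Sup_subset_mono) (auto simp: maximals_def)
  show "Sup S \<le> Sup (maximals S)"
  proof (rule Sup_least)
    fix y assume "y \<in> S"
    then obtain m where m: "m \<in> S" "y \<le> m" "\<forall>z\<in>S. m \<le> z \<longrightarrow> m = z"
      using finite_has_maximal2[of S y] by auto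
    then have "m \<in> maximals S" by (auto simp: maximals_def)
    then show "y \<le> Sup (maximals S)" using m(2) by (meson Sup_upper order_trans)
  qed
qed

text \<open>An antichain with at least two members lies strictly below its join. Conversely, the
  maximal elements of \<open>W\<close> strictly below \<open>C\<close> form an antichain with the
  same join; fewer than two of them could only join to \<open>bot\<close> or to an element smaller
  than \<open>C\<close>.\<close>

lemma nested_sets_iff:
  fixes G :: "'a::{finite, complete_lattice} set"
  assumes "bot \<notin> G"
  shows "W \<in> nested_sets G \<longleftrightarrow> W \<subseteq> G \<and> (\<forall>C\<in>G. Sup {y\<in>W. y < C} \<noteq> C)"
proof
  assume W: "W \<in> nested_sets G"
  have "Sup {y\<in>W. y < C} \<noteq> C" if C: "C \<in> G" for C
  proof
    assume eq: "Sup {y\<in>W. y < C} = C"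
    define T where "T = maximals {y\<in>W. y < C}"
    have S: "Sup T = C" unfolding T_def Sup_maximals by (rule eq)
    have sub: "T \<subseteq> {y\<in>W. y < C}" by (auto simp: T_def maximals_def)
    have "card T \<ge> 2"
    proof (rule ccontr)
      assume "\<not> card T \<ge> 2"
      then have "card T = 0 \<or> card T = 1" by linarith
      then consider "T = {}" | t where "T = {t}" by (auto simp: card_1_singleton_iff)
      then show False
      proof cases
        case 1 then show False using S C assms by auto
      next
        case 2 then show False using S sub by auto
      qed
    qed
    moreover have "\<forall>x\<in>T. \<forall>y\<in>T. x \<noteq> y \<longrightarrow> \<not> x \<le> y"
      by (auto simp: T_def maximals_def)
    moreover have "T \<subseteq> W" using sub by auto
    ultimately have "Sup T \<notin> G"
      using W by (simp add: nested_sets_def)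
    then show False using S C by simp
  qed
  then show "W \<subseteq> G \<and> (\<forall>C\<in>G. Sup {y\<in>W. y < C} \<noteq> C)"
    using W by (auto simp: nested_sets_def)
next
  assume R: "W \<subseteq> G \<and> (\<forall>C\<in>G. Sup {y\<in>W. y < C} \<noteq> C)"
  have "Sup T \<notin> G" if T: "T \<subseteq> W" "card T \<ge> 2" "\<forall>x\<in>T. \<forall>y\<in>T. x \<noteq> y \<longrightarrow> \<not> x \<le> y" for T
  proof
    assume G: "Sup T \<in> G"
    have "t < Sup T" if t: "t \<in> T" for t
    proof (rule ccontr)
      assume "\<not> t < Sup T"
      then have "t = Sup T" using t by (meson Sup_upper order_le_less)
      then have "\<forall>y\<in>T. y \<le> t" by (simp add: Sup_upper)
      then have "T = {t}" using T(3) t by blast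
      then show False using T(2) by simp
    qed
    then have "T \<subseteq> {y\<in>W. y < Sup T}" using T(1) by auto
    then have "Sup T \<le> Sup {y\<in>W. y < Sup T}" by (rule Sup_subset_mono)
    then have "Sup {y\<in>W. y < Sup T} = Sup T" using Sup_lt_le by (metis antisym)
    then show False using R G by blast
  qed
  then show "W \<in> nested_sets G" using R by (auto simp: nested_sets_def)
qed

text \<open>Nestedness becomes positivity of all exponent bounds, which is how nested sets enter the
  count of monomials.\<close>

lemma nested_sets_iff_atom_dist:
  fixes G :: "'a::{finite, complete_lattice} set"
  assumes "atomic TYPE('a)" and "bot \<notin> G"
  shows "W \<in> nested_sets G \<longleftrightarrow> W \<subseteq> G \<and> (\<forall>C\<in>G. 0 < atom_dist (Sup {y\<in>W. y < C}) C)"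
  unfolding nested_sets_iff[OF assms(2)]
  by (simp add: atom_dist_eq_0_iff[OF assms(1) Sup_lt_le] flip: neq0_conv)

lemma nested_sets_subset: "W \<in> nested_sets G \<Longrightarrow> V \<subseteq> W \<Longrightarrow> V \<in> nested_sets G"
  by (auto simp: nested_sets_def)

section \<open>Integer polynomials and their ideals\<close>

text \<open>The carrier of \<open>zpoly_ring V\<close> as a plain set: calculations take place in
  the type of all polynomials, and membership is tracked separately.\<close>

definition polys_in :: "'a set \<Rightarrow> 'a zpoly set" where
  "polys_in V = {p. \<forall>m\<in>Poly_Mapping.keys p. Poly_Mapping.keys m \<subseteq> V}"

definition monomial :: "('a \<Rightarrow>\<^sub>0 nat) \<Rightarrow> 'a zpoly" where
  "monomial m = Poly_Mapping.single m 1"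

lemma polys_in_0 [simp]: "0 \<in> polys_in V"
  by (simp add: polys_in_def)

lemma polys_in_1 [simp]: "1 \<in> polys_in V"
  by (simp add: polys_in_def)

lemma polys_in_add: "p \<in> polys_in V \<Longrightarrow> q \<in> polys_in V \<Longrightarrow> p + q \<in> polys_in V"
  using keys_add[of p q] unfolding polys_in_def by blast

lemma polys_in_uminus: "p \<in> polys_in V \<Longrightarrow> - p \<in> polys_in V"
  unfolding polys_in_def by simp

lemma polys_in_diff: "p \<in> polys_in V \<Longrightarrow> q \<in> polys_in V \<Longrightarrow> p - q \<in> polys_in V"
  using polys_in_add[of p V "- q"] polys_in_uminus by auto

lemma polys_in_mult:
  assumes "p \<in> polys_in V" "q \<in> polys_in V" shows "p * q \<in> polys_in V"
  unfolding polys_in_def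
proof safe
  fix m x assume m: "m \<in> Poly_Mapping.keys (p * q)" and x: "x \<in> Poly_Mapping.keys m"
  then obtain a b where "m = a + b" "a \<in> Poly_Mapping.keys p" "b \<in> Poly_Mapping.keys q"
    using keys_mult[of p q] by auto
  moreover have "Poly_Mapping.keys a \<subseteq> V" "Poly_Mapping.keys b \<subseteq> V"
    using assms calculation by (auto simp: polys_in_def)
  ultimately show "x \<in> V" using x keys_add[of a b] by blast
qed

lemma polys_in_power: "p \<in> polys_in V \<Longrightarrow> p ^ n \<in> polys_in V"
  by (induction n) (auto intro: polys_in_mult)

lemma polys_in_sum: "(\<And>i. i \<in> A \<Longrightarrow> f i \<in> polys_in V) \<Longrightarrow> sum f A \<in> polys_in V"
  by (induction A rule: infinite_finite_induct) (auto intro: polys_in_add)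

lemma polys_in_prod: "(\<And>i. i \<in> A \<Longrightarrow> f i \<in> polys_in V) \<Longrightarrow> prod f A \<in> polys_in V"
  by (induction A rule: infinite_finite_induct) (auto intro: polys_in_mult)

lemma polys_in_var: "a \<in> V \<Longrightarrow> var a \<in> polys_in V"
  by (simp add: polys_in_def var_def)

lemma polys_in_of_int: "of_int c \<in> polys_in V"
  by (auto simp: polys_in_def simp flip: single_of_int)

lemma polys_in_of_nat: "of_nat c \<in> polys_in V"
  by (auto simp: polys_in_def simp flip: single_of_nat)

section \<open>Expansion of polynomials into monomials\<close>

lemma poly_mapping_eq_sum_single:
  "p = (\<Sum>m\<in>Poly_Mapping.keys p. Poly_Mapping.single m (Poly_Mapping.lookup p m))"
proof (rule poly_mapping_eqI)
  fix k
  have "Poly_Mapping.lookup (\<Sum>m\<in>Poly_Mapping.keys p. Poly_Mapping.single m (Poly_Mapping.lookup p m)) k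
    = (\<Sum>m\<in>Poly_Mapping.keys p. if m = k then Poly_Mapping.lookup p m else 0)"
    by (auto simp: lookup_sum lookup_single when_def intro!: sum.cong)
  also have "\<dots> = Poly_Mapping.lookup p k"
    by (simp add: in_keys_iff)
  finally show "Poly_Mapping.lookup p k =
    Poly_Mapping.lookup (\<Sum>m\<in>Poly_Mapping.keys p. Poly_Mapping.single m (Poly_Mapping.lookup p m)) k" ..
qed

lemma of_int_mult_mono: "of_int c * monomial m = Poly_Mapping.single m c"
  by (simp add: monomial_def mult_single flip: single_of_int)

lemma zpoly_eq_sum_mono:
  "p = (\<Sum>m\<in>Poly_Mapping.keys p. of_int (Poly_Mapping.lookup p m) * monomial m)"
  unfolding of_int_mult_mono by (rule poly_mapping_eq_sum_single)

lemma monomial_0 [simp]: "monomial 0 = 1"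
  by (simp add: monomial_def)

lemma monomial_add: "monomial (m + n) = monomial m * monomial n"
  by (simp add: monomial_def mult_single)

lemma monomial_sum: "monomial (sum f A) = (\<Prod>a\<in>A. monomial (f a))"
  by (induction A rule: infinite_finite_induct) (auto simp: monomial_add)

lemma var_power: "var a ^ n = monomial (Poly_Mapping.single a n)"
  by (induction n) (auto simp: var_def monomial_def mult_single simp flip: single_add)

lemma monomial_eq_prod:
  fixes m :: "'a::finite \<Rightarrow>\<^sub>0 nat"
  shows "monomial m = (\<Prod>a\<in>UNIV. var a ^ Poly_Mapping.lookup m a)"
proof -
  have "m = (\<Sum>a\<in>UNIV. Poly_Mapping.single a (Poly_Mapping.lookup m a))"
    by (rule trans[OF poly_mapping_eq_sum_single], rule sum.mono_neutral_left) (auto simp: in_keys_iff)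
  then have "monomial m = monomial (\<Sum>a\<in>UNIV. Poly_Mapping.single a (Poly_Mapping.lookup m a))"
    by (rule arg_cong)
  also have "\<dots> = (\<Prod>a\<in>UNIV. monomial (Poly_Mapping.single a (Poly_Mapping.lookup m a)))"
    by (rule monomial_sum)
  finally have "monomial m = (\<Prod>a\<in>UNIV. monomial (Poly_Mapping.single a (Poly_Mapping.lookup m a)))" .
  then show ?thesis by (simp add: var_power)
qed

text \<open>Additivity allows both factors to be expanded into single terms, which reduces the
  general case to a product of two terms.\<close>

lemma zpoly_mult_if_mult_single:
  fixes f :: "'a zpoly \<Rightarrow> 'r::comm_ring_1"
  assumes add: "\<And>p q. f (p + q) = f p + f q"
    and mult: "\<And>m c n d. f (Poly_Mapping.single m c * Poly_Mapping.single n d)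
      = f (Poly_Mapping.single m c) * f (Poly_Mapping.single n d)"
  shows "f (p * q) = f p * f q"
proof -
  have "f 0 = 0" using add[of 0 0] by simp
  then have s: "f (sum g A) = (\<Sum>a\<in>A. f (g a))" for g :: "('a \<Rightarrow>\<^sub>0 nat) \<Rightarrow> 'a zpoly" and A
    by (induction A rule: infinite_finite_induct) (auto simp: add)
  let ?s = "\<lambda>p m. Poly_Mapping.single m (Poly_Mapping.lookup p m)"
  have "p * q = (\<Sum>m\<in>Poly_Mapping.keys p. \<Sum>n\<in>Poly_Mapping.keys q. ?s p m * ?s q n)"
    unfolding sum_product[symmetric] by (simp only: poly_mapping_eq_sum_single[symmetric])
  then have "f (p * q) = f (\<Sum>m\<in>Poly_Mapping.keys p. \<Sum>n\<in>Poly_Mapping.keys q. ?s p m * ?s q n)"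
    by (rule arg_cong)
  also have "\<dots> = (\<Sum>m\<in>Poly_Mapping.keys p. \<Sum>n\<in>Poly_Mapping.keys q. f (?s p m) * f (?s q n))"
    by (simp only: s mult)
  also have "\<dots> = f p * f q"
    unfolding sum_product[symmetric] s[symmetric]
      by (simp only: poly_mapping_eq_sum_single[symmetric])
  finally show ?thesis .
qed

text \<open>The evaluation homomorphism that sends the variable of \<open>a\<close> to
  \<open>f a\<close>. The product can range over \<open>UNIV\<close> because the index type is
  finite and absent variables contribute \<open>1\<close>.\<close>

definition poly_eval :: "('a::finite \<Rightarrow> 'r::comm_ring_1) \<Rightarrow> 'a zpoly \<Rightarrow> 'r" where
  "poly_eval f p = (\<Sum>m\<in>Poly_Mapping.keys p.
     of_int (Poly_Mapping.lookup p m) * (\<Prod>a\<in>UNIV. f a ^ Poly_Mapping.lookup m a))"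

lemma poly_eval_superset:
  assumes "finite A" "Poly_Mapping.keys p \<subseteq> A"
  shows "poly_eval f p = (\<Sum>m\<in>A.
     of_int (Poly_Mapping.lookup p m) * (\<Prod>a\<in>UNIV. f a ^ Poly_Mapping.lookup m a))"
  unfolding poly_eval_def using assms
  by (intro sum.mono_neutral_left) (auto simp: in_keys_iff)

lemma poly_eval_add: "poly_eval f (p + q) = poly_eval f p + poly_eval f q"
proof -
  let ?A = "Poly_Mapping.keys p \<union> Poly_Mapping.keys q"
  show ?thesis
    using keys_add[of p q]
    by (simp add: poly_eval_superset[of ?A] lookup_add distrib_right sum.distrib)
qed

lemma poly_eval_single:
  "poly_eval f (Poly_Mapping.single m c) = of_int c * (\<Prod>a\<in>UNIV. f a ^ Poly_Mapping.lookup m a)"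
  by (subst poly_eval_superset[of "{m}"]) auto

lemma poly_eval_mult: "poly_eval f (p * q) = poly_eval f p * poly_eval f q"
  by (rule zpoly_mult_if_mult_single)
    (auto simp: poly_eval_add poly_eval_single mult_single lookup_add power_add prod.distrib)

lemma poly_eval_0 [simp]: "poly_eval f 0 = 0"
  by (simp add: poly_eval_def)

lemma poly_eval_1 [simp]: "poly_eval f 1 = 1"
  using poly_eval_single[of f 0 1] by simp

lemma poly_eval_sum: "poly_eval f (sum g A) = (\<Sum>a\<in>A. poly_eval f (g a))"
  by (induction A rule: infinite_finite_induct) (auto simp: poly_eval_add)

lemma poly_eval_power: "poly_eval f (p ^ n) = poly_eval f p ^ n"
  by (induction n) (auto simp: poly_eval_mult)

lemma poly_eval_var [simp]: "poly_eval f (var a) = f a"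
proof -
  have "(\<Prod>b\<in>UNIV. f b ^ Poly_Mapping.lookup (Poly_Mapping.single a (1::nat)) b)
      = (\<Prod>b\<in>UNIV. if b = a then f a else 1)"
    by (rule prod.cong) (auto simp: lookup_single when_def)
  then show ?thesis by (simp add: var_def poly_eval_single)
qed

lemma poly_eval_of_var: "poly_eval var p = p"
proof -
  have "poly_eval var p = (\<Sum>m\<in>Poly_Mapping.keys p. of_int (Poly_Mapping.lookup p m) * monomial m)"
    by (simp add: poly_eval_def monomial_eq_prod)
  also have "\<dots> = p" by (rule zpoly_eq_sum_mono[symmetric])
  finally show ?thesis .
qed

lemma poly_eval_cong:
  assumes "p \<in> polys_in V" and "\<And>a. a \<in> V \<Longrightarrow> f a = g a"
  shows "poly_eval f p = poly_eval g p"
  unfolding poly_eval_def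
proof (intro sum.cong refl arg_cong2[where f = "(*)"] prod.cong)
  fix m a assume "m \<in> Poly_Mapping.keys p"
  then have "Poly_Mapping.keys m \<subseteq> V" using assms(1) by (auto simp: polys_in_def)
  then show "f a ^ Poly_Mapping.lookup m a = g a ^ Poly_Mapping.lookup m a"
  proof (cases "a \<in> Poly_Mapping.keys m")
    case True
    then have "a \<in> V" using \<open>Poly_Mapping.keys m \<subseteq> V\<close> by blast
    then show ?thesis by (simp add: assms(2))
  qed (simp add: in_keys_iff)
qed

lemma poly_eval_in_polys_in:
  fixes f :: "'a::finite \<Rightarrow> 'b zpoly"
  assumes "\<And>a. f a \<in> polys_in V" shows "poly_eval f p \<in> polys_in V"
  unfolding poly_eval_def
  by (intro polys_in_sum polys_in_mult polys_in_prod polys_in_power polys_in_of_int assms)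

section \<open>Polynomials as univariate polynomials in a distinguished variable\<close>

definition split_var :: "'a::finite \<Rightarrow> 'a zpoly \<Rightarrow> 'a zpoly poly" where
  "split_var b = poly_eval (\<lambda>a. if a = b then [:0, 1:] else [:var a:])"

lemma poly_split_var: "poly (split_var b p) (var b) = p"
proof -
  have "poly (split_var b p) (var b) = poly_eval (\<lambda>a. poly (if a
    = b then [:0, 1:] else [:var a:]) (var b)) p"
    by (simp add: split_var_def poly_eval_def poly_sum poly_prod)
  also have "\<dots> = poly_eval var p"
    by (rule arg_cong[where f = "\<lambda>f. poly_eval f p"]) auto
  finally show ?thesis by (simp add: poly_eval_of_var)
qed

lemma split_var_single:
  "split_var b (Poly_Mapping.single m c) =
    monom (Poly_Mapping.single (m - Poly_Mapping.single b (Poly_Mapping.lookup m b)) c) (Poly_Mapping.lookup m b)"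
proof -
  let ?n = "m - Poly_Mapping.single b (Poly_Mapping.lookup m b)"
  let ?g = "\<lambda>a. if a = b then [:0, 1:] else [:var a:]"
  have "(\<Prod>a\<in>UNIV. ?g a ^ Poly_Mapping.lookup m a)
      = [:0, 1:] ^ Poly_Mapping.lookup m b * (\<Prod>a\<in>UNIV - {b}. ?g a ^ Poly_Mapping.lookup m a)"
    by (subst prod.remove[of _ b]) auto
  also have "(\<Prod>a\<in>UNIV - {b}. ?g a ^ Poly_Mapping.lookup m a)
      = (\<Prod>a\<in>UNIV - {b}. [:var a ^ Poly_Mapping.lookup m a:])"
    by (rule prod.cong) (auto simp: poly_const_pow)
  also have "\<dots> = [:\<Prod>a\<in>UNIV - {b}. var a ^ Poly_Mapping.lookup m a:]"
  proof -
    have "(\<Prod>a\<in>A. [:h a:]) = [:\<Prod>a\<in>A. h a:]" if "finite A" for A and h :: "'a \<Rightarrow> 'a zpoly"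
      using that by (induction A) (auto simp: pCons_one)
    then show ?thesis by simp
  qed
  also have "(\<Prod>a\<in>UNIV - {b}. var a ^ Poly_Mapping.lookup m a) = monomial ?n"
  proof -
    have "monomial ?n = var b ^ Poly_Mapping.lookup ?n b * (\<Prod>a\<in>UNIV - {b}. var a ^ Poly_Mapping.lookup ?n a)"
      unfolding monomial_eq_prod by (subst prod.remove[of _ b]) auto
    also have "\<dots> = (\<Prod>a\<in>UNIV - {b}. var a ^ Poly_Mapping.lookup m a)"
      by (simp add: lookup_minus) (auto simp: lookup_single when_def intro!: prod.cong)
    finally show ?thesis ..
  qed
  finally have "(\<Prod>a\<in>UNIV. ?g a ^ Poly_Mapping.lookup m a)
    = monom (monomial ?n) (Poly_Mapping.lookup m b)"
    by (simp add: monom_altdef mult.commute)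
  then have "split_var b (Poly_Mapping.single m c)
    = of_int c * monom (monomial ?n) (Poly_Mapping.lookup m b)"
    by (simp add: split_var_def poly_eval_single)
  also have "\<dots> = monom (Poly_Mapping.single ?n c) (Poly_Mapping.lookup m b)"
    by (simp add: of_int_poly smult_monom of_int_mult_mono)
  finally show ?thesis .
qed

lemma split_var_eq:
  "split_var b p = (\<Sum>m\<in>Poly_Mapping.keys p. monom (Poly_Mapping.single
     (m - Poly_Mapping.single b (Poly_Mapping.lookup m b)) (Poly_Mapping.lookup p m)) (Poly_Mapping.lookup m b))"
proof -
  have "split_var b p = split_var b (\<Sum>m\<in>Poly_Mapping.keys p. Poly_Mapping.single m (Poly_Mapping.lookup p m))"
    by (rule arg_cong[OF poly_mapping_eq_sum_single])
  also have "\<dots> = (\<Sum>m\<in>Poly_Mapping.keys p. split_var b (Poly_Mapping.single m (Poly_Mapping.lookup p m)))"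
    by (simp add: split_var_def poly_eval_sum)
  finally show ?thesis by (simp add: split_var_single)
qed

text \<open>The type of the coefficients would allow \<open>var b\<close> to occur in them. This
  inclusion excludes that: degree \<open>i\<close> collects the monomials with exponent exactly
  \<open>i\<close> at \<open>b\<close>, with that power removed.\<close>

lemma keys_coeff_split_var:
  "Poly_Mapping.keys (coeff (split_var b p) i) \<subseteq>
    {m - Poly_Mapping.single b i | m. m \<in> Poly_Mapping.keys p \<and> Poly_Mapping.lookup m b = i}"
proof
  fix k assume "k \<in> Poly_Mapping.keys (coeff (split_var b p) i)"
  then have "k \<in> (\<Union>m\<in>Poly_Mapping.keys p. Poly_Mapping.keys (coeff (monom (Poly_Mapping.single
     (m - Poly_Mapping.single b (Poly_Mapping.lookup m b)) (Poly_Mapping.lookup p m)) (Poly_Mapping.lookup m b)) i))"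
    unfolding split_var_eq coeff_sum by (rule subsetD[OF keys_sum])
  then show "k \<in> {m - Poly_Mapping.single b i | m. m \<in> Poly_Mapping.keys p
    \<and> Poly_Mapping.lookup m b = i}"
    by (auto simp: coeff_monom split: if_splits)
qed

lemma split_var_const:
  assumes "p \<in> polys_in (- {b})" shows "split_var b p = [:p:]"
proof -
  have z: "Poly_Mapping.lookup m b = 0" if "m \<in> Poly_Mapping.keys p" for m
    using assms that by (force simp: polys_in_def in_keys_iff)
  have "split_var b p = (\<Sum>m\<in>Poly_Mapping.keys p. [:Poly_Mapping.single m (Poly_Mapping.lookup p m):])"
    unfolding split_var_eq by (rule sum.cong) (auto simp: z monom_0)
  also have "\<dots> = [:\<Sum>m\<in>Poly_Mapping.keys p. Poly_Mapping.single m (Poly_Mapping.lookup p m):]"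
  proof -
    have "(\<Sum>a\<in>A. [:h a:]) = [:\<Sum>a\<in>A. h a:]" if "finite A" for A and h :: "('a \<Rightarrow>\<^sub>0 nat) \<Rightarrow> 'a zpoly"
      using that by (induction A) auto
    then show ?thesis by simp
  qed
  also have "\<dots> = [:p:]" by (simp only: poly_mapping_eq_sum_single[symmetric])
  finally show ?thesis .
qed

lemma split_var_var: "split_var b (var b) = [:0, 1:]"
  by (simp add: split_var_def)

lemma split_var_add: "split_var b (p + q) = split_var b p + split_var b q"
  by (simp add: split_var_def poly_eval_add)

lemma split_var_mult: "split_var b (p * q) = split_var b p * split_var b q"
  by (simp add: split_var_def poly_eval_mult)

lemma split_var_0 [simp]: "split_var b 0 = 0"
  by (simp add: split_var_def)

text \<open>Ideals of a type-class ring, built up one multiple at a time, so that rule induction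
  only has to treat zero and the addition of a multiple of one generator.\<close>

inductive_set ideal_span :: "'r::comm_ring_1 set \<Rightarrow> 'r set" for X where
  zero [simp, intro]: "0 \<in> ideal_span X"
| step: "x \<in> ideal_span X \<Longrightarrow> g \<in> X \<Longrightarrow> r * g + x \<in> ideal_span X"

lemma ideal_span_base: "g \<in> X \<Longrightarrow> g \<in> ideal_span X"
  using ideal_span.step[of 0 X g 1] by simp

lemma ideal_span_add: "x \<in> ideal_span X \<Longrightarrow> y \<in> ideal_span X \<Longrightarrow> x + y \<in> ideal_span X"
  by (induction rule: ideal_span.induct) (auto simp: add.assoc intro: ideal_span.step)

lemma ideal_span_mult: "x \<in> ideal_span X \<Longrightarrow> r * x \<in> ideal_span X"
proof (induction rule: ideal_span.induct)
  case (step x g s)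
  have "r * (s * g + x) = (r * s) * g + r * x" by (simp add: algebra_simps)
  then show ?case using step ideal_span.step by metis
qed simp

lemma ideal_span_uminus: "x \<in> ideal_span X \<Longrightarrow> - x \<in> ideal_span X"
  using ideal_span_mult[of x X "- 1"] by simp

lemma ideal_span_diff: "x \<in> ideal_span X \<Longrightarrow> y \<in> ideal_span X \<Longrightarrow> x - y \<in> ideal_span X"
  using ideal_span_add[of x X "- y"] ideal_span_uminus by auto

lemma ideal_span_sum: "(\<And>i. i \<in> A \<Longrightarrow> f i \<in> ideal_span X) \<Longrightarrow> sum f A \<in> ideal_span X"
  by (induction A rule: infinite_finite_induct) (auto intro: ideal_span_add)

lemma ideal_span_minimal:
  assumes "\<And>g. g \<in> X \<Longrightarrow> g \<in> ideal_span Y" shows "ideal_span X \<subseteq> ideal_span Y"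
proof
  fix x assume "x \<in> ideal_span X"
  then show "x \<in> ideal_span Y"
    by induction (auto intro: ideal_span_add ideal_span_mult assms)
qed

lemma ideal_span_dvd: "x \<in> ideal_span X \<Longrightarrow> x dvd y \<Longrightarrow> y \<in> ideal_span X"
  by (auto simp: dvd_def mult.commute intro: ideal_span_mult)

lemma diff_dvd_power_diff: "x - y dvd x ^ n - (y::'r::comm_ring_1) ^ n"
  by (simp add: power_diff_sumr2)

section \<open>A monomial basis of the quotient by the relations\<close>

definition up_sum :: "'a::order set \<Rightarrow> 'a \<Rightarrow> 'a zpoly" where
  "up_sum G B = (\<Sum>C\<in>{C\<in>G. B \<le> C}. var C)"

text \<open>\<open>Q\<close> limits \<open>H\<close> and the target, whereas the sums still run over
  \<open>G\<close>. For \<open>Q\<close> closed upwards in \<open>G\<close> these are relations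
  among the variables of \<open>Q\<close>, and elements can be removed from \<open>Q\<close> at the
  bottom.\<close>

definition relations :: "'a::{finite, complete_lattice} set \<Rightarrow> 'a set \<Rightarrow> 'a set \<Rightarrow> 'a zpoly set" where
  "relations G Q I = {relation_poly G I H C | H C. H \<subseteq> Q \<and> C \<in> Q \<and> (\<forall>h\<in>H. h < C)}"

text \<open>If some \<open>C\<close> in \<open>Q\<close> is already the join of the elements of
  \<open>I\<close> below it, this set is empty. That is consistent: the relation with empty
  \<open>H\<close> and target \<open>C\<close> is then \<open>1\<close>.\<close>

definition standard_monomials ::
    "'a::{finite, complete_lattice} set \<Rightarrow> 'a set \<Rightarrow> ('a \<Rightarrow>\<^sub>0 nat) set" where
  "standard_monomials Q I = {m. Poly_Mapping.keys m \<subseteq> Q \<and>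
     (\<forall>C\<in>Q. Poly_Mapping.lookup m C < atom_dist (Sup {y \<in> I \<union> Poly_Mapping.keys m. y < C}) C)}"

lemma relation_poly_eq:
  "relation_poly G I H C = (\<Prod>A\<in>H. var A) * up_sum G C ^ atom_dist (Sup (H \<union> {y\<in>I. y < C})) C"
  by (simp add: relation_poly_def up_sum_def join_defect_eq)

lemma relation_poly_dvd:
  "atom_dist (Sup (H \<union> {y\<in>I. y < C})) C \<le> n \<Longrightarrow>
    relation_poly G I H C dvd (\<Prod>A\<in>H. var A) * up_sum G C ^ n"
  unfolding relation_poly_eq by (intro mult_dvd_mono le_imp_power_dvd) auto

text \<open>Exponents above the prescribed one are allowed, so membership proofs only require an
  upper bound for a distance.\<close>

lemma in_ideal_relations:
  assumes "H \<subseteq> Q" "C \<in> Q" "\<forall>h\<in>H. h < C" "atom_dist (Sup (H \<union> {y\<in>I. y < C})) C \<le> n"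
  shows "(\<Prod>A\<in>H. var A) * up_sum G C ^ n \<in> ideal_span (relations G Q I)"
proof (rule ideal_span_dvd[OF ideal_span_base relation_poly_dvd[OF assms(4)]])
  show "relation_poly G I H C \<in> relations G Q I"
    using assms unfolding relations_def by blast
qed

lemma coeff_pow_linear_0: "coeff ([:u, 1:] ^ d) 0 = (u::'r::comm_ring_1) ^ d"
  by (induction d) (auto simp: coeff_mult)

text \<open>
  The ring obtained from \<open>R/J\<close> by adjoining \<open>x\<close> subject to \<open>x k = 0\<close> for \<open>k \<in> K\<close> and to
  \<open>(x + u)\<^sup>d = 0\<close> is, as a module, \<open>R/J \<oplus> R/K x \<oplus> \<dots> \<oplus> R/K x\<^sup>d\<^sup>-\<^sup>1\<close> provided that \<open>u\<^sup>d K \<subseteq> J\<close>.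
\<close>

lemma adjoin_root_coeffs:
  fixes u :: "'r::comm_ring_1" and d :: nat
  defines "f \<equiv> [:u, 1:] ^ d"
  assumes a: "coeff a 0 \<in> ideal_span J" "\<And>i. coeff a i \<in> ideal_span K"
    and sub: "ideal_span J \<subseteq> ideal_span K"
    and kill: "\<And>k. k \<in> ideal_span K \<Longrightarrow> u ^ d * k \<in> ideal_span J"
    and deg: "\<And>i. d \<le> i \<Longrightarrow> coeff (a + f * b) i = 0"
  shows "coeff (a + f * b) 0 \<in> ideal_span J" and "coeff (a + f * b) i \<in> ideal_span K"
proof -
  have fd: "coeff f d = 1" unfolding f_def by (rule coeff_linear_power)
  have f0: "coeff f i = 0" if "i > d" for i
    unfolding f_def by (rule coeff_eq_0) (simp add: degree_linear_power that)
  \<comment> \<open>As \<open>f\<close> is monic of degree \<open>d\<close>, the last coefficient of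
    \<open>b\<close> outside the span of \<open>K\<close>, at \<open>n\<close>, reappears in degree
    \<open>n + d\<close> up to elements of that span. There the total coefficient is 0 by
    \<open>deg\<close>, a contradiction.\<close>
  have b: "coeff b j \<in> ideal_span K" for j
  proof (rule ccontr)
    assume j: "coeff b j \<notin> ideal_span K"
    let ?S = "{n. coeff b n \<notin> ideal_span K}"
    have fin: "finite ?S"
    proof (rule finite_subset)
      show "?S \<subseteq> {..degree b}"
        by (auto intro!: le_degree)
    qed simp
    define n where "n = Max ?S"
    have n: "coeff b n \<notin> ideal_span K" using Max_in[OF fin] j by (auto simp: n_def)
    have gt: "coeff b k \<in> ideal_span K" if "k > n" for k
      using Max_ge[OF fin, of k] that by (force simp: n_def)
    have "coeff (f * b) (n + d) = (\<Sum>i\<le>n + d. coeff f i * coeff b (n + d - i))"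
      by (rule coeff_mult)
    also have "\<dots> = coeff b n + (\<Sum>i\<in>{..n + d} - {d}. coeff f i * coeff b (n + d - i))"
      by (subst sum.remove[of _ d]) (auto simp: fd)
    finally have eq: "coeff b n = coeff (a + f * b) (n + d) - coeff a (n + d)
        - (\<Sum>i\<in>{..n + d} - {d}. coeff f i * coeff b (n + d - i))"
      by simp
    have "(\<Sum>i\<in>{..n + d} - {d}. coeff f i * coeff b (n + d - i)) \<in> ideal_span K"
    proof (rule ideal_span_sum)
      fix i assume "i \<in> {..n + d} - {d}"
      then consider "i < d" | "i > d" by fastforce
      then show "coeff f i * coeff b (n + d - i) \<in> ideal_span K"
        by cases (auto simp: f0 intro!: ideal_span_mult gt)
    qed
    then have "coeff b n \<in> ideal_span K"
      unfolding eq deg[OF le_add2] by (intro ideal_span_diff a(2)) auto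
    with n show False by blast
  qed
  \<comment> \<open>The constant term of \<open>f * b\<close> is \<open>u ^ d\<close> times that of
    \<open>b\<close>, and \<open>kill\<close> moves it into the span of \<open>J\<close>.\<close>
  show "coeff (a + f * b) 0 \<in> ideal_span J"
    using ideal_span_add[OF a(1) kill[OF b[of 0]]]
    by (simp add: coeff_mult_0 f_def coeff_pow_linear_0)
  show "coeff (a + f * b) i \<in> ideal_span K"
    unfolding coeff_add coeff_mult
    by (intro ideal_span_add a(2) ideal_span_sum ideal_span_mult b)
qed

text \<open>The properties of building sets on which the ring computation rests. In
  \<open>sup_overlap\<close>, \<open>B\<close> is a nonzero common lower bound of \<open>C\<close>
  and \<open>D\<close>.\<close>

locale overlap_closed =
  fixes G :: "'a::{finite, complete_lattice} set"
  assumes atomic: "atomic TYPE('a)"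
    and bot_notin: "bot \<notin> G"
    and sup_overlap: "\<lbrakk>C \<in> G; D \<in> G; B \<le> C; B \<le> D; B \<noteq> bot\<rbrakk> \<Longrightarrow> sup C D \<in> G"
begin

text \<open>A larger \<open>I\<close> raises the starting point of each distance and so lowers the
  exponents. Hence every relation for \<open>I\<close> is a multiple of one for
  \<open>insert B I\<close>.\<close>

lemma ideal_relations_insert:
  "ideal_span (relations G Q I) \<subseteq> ideal_span (relations G Q (insert B I))"
proof (rule ideal_span_minimal)
  fix g assume "g \<in> relations G Q I"
  then obtain H C where *: "g = relation_poly G I H C" "H \<subseteq> Q" "C \<in> Q" "\<forall>h\<in>H. h < C"
    unfolding relations_def by blast
  let ?v = "Sup (H \<union> {y\<in>insert B I. y < C})"
  have "?v \<le> C" using *(4) by (intro Sup_least) (auto simp: less_imp_le)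
  then have "atom_dist ?v C \<le> atom_dist (Sup (H \<union> {y\<in>I. y < C})) C"
    using *(4) by (intro atom_dist_mono_sup[OF atomic])
      (auto intro!: Sup_least Sup_subset_mono simp: less_imp_le sup.absorb2)
  then show "g \<in> ideal_span (relations G Q (insert B I))"
    unfolding *(1) relation_poly_eq by (intro in_ideal_relations *)
qed

section \<open>Multiplying the ideal for \<open>insert B I\<close> into the ideal for
  \<open>I\<close>\<close>

context
  fixes Q B
  assumes B: "B \<in> G" and Q: "Q \<subseteq> G" and up: "\<And>C. C \<in> G \<Longrightarrow> B < C \<Longrightarrow> C \<in> Q"
begin

lemma sup_above: "C \<in> G \<Longrightarrow> D \<in> G \<Longrightarrow> B < C \<Longrightarrow> B < D \<Longrightarrow> sup C D \<in> G"
  using B bot_notin by (intro sup_overlap[of C D B]) auto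

text \<open>The join of \<open>C\<close> and \<open>D\<close> lies in \<open>G\<close>, since both
  are above \<open>B\<close>. The relation with \<open>H = {C, D}\<close> and this join as target
  has exponent 0.\<close>

lemma incomparable_prod:
  assumes "C \<in> G" "D \<in> G" "B < C" "B < D" "\<not> C \<le> D" "\<not> D \<le> C"
  shows "var C * var D \<in> ideal_span (relations G Q I)"
proof -
  let ?E = "sup C D"
  have E: "?E \<in> Q" by (intro up sup_above assms less_supI1)
  have lt: "C < ?E" "D < ?E" using assms(5,6)
    by (metis less_le sup.cobounded1 sup.orderI sup.cobounded2 sup_commute)+
  have "Sup ({C, D} \<union> {y\<in>I. y < ?E}) = ?E"
  proof (rule antisym)
    show "Sup ({C, D} \<union> {y\<in>I. y < ?E}) \<le> ?E" by (rule Sup_least) (auto simp: less_imp_le)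
    show "?E \<le> Sup ({C, D} \<union> {y\<in>I. y < ?E})" by (intro sup_least Sup_upper) auto
  qed
  then have "atom_dist (Sup ({C, D} \<union> {y\<in>I. y < ?E})) ?E \<le> 0" by simp
  then have "(\<Prod>A\<in>{C, D}. var A) * up_sum G ?E ^ 0 \<in> ideal_span (relations G Q I)"
    using assms lt E by (intro in_ideal_relations) (auto intro: up)
  moreover have "C \<noteq> D" using assms by auto
  ultimately show ?thesis by simp
qed

text \<open>The two sums differ by the variables of those \<open>E\<close> above \<open>C\<close>
  that are not above \<open>D\<close>. Such \<open>E\<close> are incomparable with \<open>D\<close>,
  so their products with \<open>var D\<close> lie in the ideal.\<close>

lemma var_up_sum_cong:
  assumes "C \<in> G" "D \<in> G" "B < C" "B < D" "\<not> C \<le> D" "\<not> D \<le> C"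
  shows "var D * (up_sum G C - up_sum G (sup C D)) \<in> ideal_span (relations G Q I)"
proof -
  have "up_sum G C = up_sum G (sup C D) + (\<Sum>E\<in>{E\<in>G. C \<le> E \<and> \<not> D \<le> E}. var E)"
    unfolding up_sum_def by (subst sum.union_disjoint[symmetric]) (auto intro!: sum.cong)
  then have "var D * (up_sum G C - up_sum G (sup C D))
      = (\<Sum>E\<in>{E\<in>G. C \<le> E \<and> \<not> D \<le> E}. var D * var E)"
    by (simp add: sum_distrib_left)
  also have "\<dots> \<in> ideal_span (relations G Q I)"
    using assms by (intro ideal_span_sum incomparable_prod) auto
  finally show ?thesis .
qed

text \<open>The target of the relation used is not \<open>C\<close> but \<open>sup C D\<close>: multiplied
  by the variable of \<open>D\<close>, the
  sums above \<open>C\<close> and above \<open>sup C D\<close> agree.\<close>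

lemma var_times_relation:
  assumes H: "H \<subseteq> Q" "C \<in> Q" "\<forall>h\<in>H. h < C" "B < C"
    and D: "D \<in> G" "B < D" "\<not> C \<le> D"
  shows "var D * relation_poly G (insert B I) H C \<in> ideal_span (relations G Q I)"
proof -
  let ?J = "ideal_span (relations G Q I)"
  let ?u = "Sup (H \<union> {y\<in>insert B I. y < C})"
  define e where "e = atom_dist ?u C"
  define E where "E = sup C D"
  have C: "C \<in> G" using H Q by auto
  have CE: "C \<le> E" and DE: "D \<le> E" by (auto simp: E_def)
  have E: "E \<in> Q" "D < E" "C \<le> E"
  proof -
    show "C \<le> E" by (rule CE)
    show "D < E" using D(3) CE DE by (auto simp: less_le)
    show "E \<in> Q" using up[of E] sup_above[OF C D(1) H(4) D(2)] less_le_trans[OF H(4) CE]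
      by (simp add: E_def)
  qed
  have u: "?u \<le> C" using H(3) by (intro Sup_least) (auto simp: less_imp_le)
  have main: "var D * (\<Prod>A\<in>H. var A) * up_sum G E ^ e \<in> ?J"
  proof -
    let ?H = "insert D H"
    let ?v = "Sup (?H \<union> {y\<in>I. y < E})"
    have vE: "?v \<le> E" using H(3) E by (intro Sup_least) (auto simp: less_imp_le intro: order.strict_implies_order order.trans)
    have Dv: "D \<le> ?v" by (auto intro: Sup_upper)
    \<comment> \<open>\<open>B\<close> need not occur in the join \<open>?v\<close>, but it lies
      below \<open>D\<close>, which does.\<close>
    have "?u \<le> ?v"
    proof (rule Sup_least)
      fix y assume "y \<in> H \<union> {y\<in>insert B I. y < C}"
      then consider "y \<in> ?H \<union> {y\<in>I. y < E}" | "y = B"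
        using less_le_trans[OF _ E(3), of y] by auto
      then show "y \<le> ?v"
      proof cases
        case 2 then show ?thesis using order.trans[OF less_imp_le[OF D(2)] Dv] by (simp only:)
      qed (rule Sup_upper)
    qed
    moreover have "E = sup ?v C"
      by (rule antisym) (use Dv vE E(3) in \<open>auto simp: E_def intro: le_supI1\<close>)
    ultimately have "atom_dist ?v E \<le> e"
      unfolding e_def by (intro atom_dist_mono_sup[OF atomic u])
    then have "(\<Prod>A\<in>?H. var A) * up_sum G E ^ e \<in> ?J"
      using H E D by (intro in_ideal_relations) (auto intro: up order.strict_trans2)
    \<comment> \<open>Only divisibility holds in general, since \<open>D\<close> may already belong
      to \<open>H\<close>.\<close>
    moreover have "(\<Prod>A\<in>?H. var A) dvd var D * (\<Prod>A\<in>H. var A)"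
      by (cases "D \<in> H") (auto simp: insert_absorb prod.insert)
    ultimately show ?thesis by (rule ideal_span_dvd[OF _ mult_dvd_mono[OF _ dvd_refl]])
  qed
  show ?thesis
  proof (cases "D \<le> C")
    case True
    then have "E = C" by (simp add: E_def sup.absorb1)
    then show ?thesis using main by (simp add: relation_poly_eq e_def mult.assoc)
  next
    case False
    have "var D * (up_sum G C - up_sum G E) dvd
        var D * (\<Prod>A\<in>H. var A) * (up_sum G C ^ e - up_sum G E ^ e)"
      by (rule mult_dvd_mono[OF dvd_triv_left diff_dvd_power_diff])
    then have "var D * (\<Prod>A\<in>H. var A) * (up_sum G C ^ e - up_sum G E ^ e) \<in> ?J"
      using var_up_sum_cong[OF C D(1) H(4) D(2,3) False] ideal_span_dvd unfolding E_def by blast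
    from ideal_span_add[OF this main] show ?thesis
      by (simp add: relation_poly_eq e_def algebra_simps)
  qed
qed

text \<open>Modulo the ideal, \<open>up_sum G B - var B\<close> may be replaced by \<open>up_sum G C\<close> next to a relation with
  target \<open>C > B\<close>, and then the exponents add up by subadditivity of \<open>atom_dist\<close>.\<close>

lemma relation_times_power:
  assumes k: "k \<in> ideal_span (relations G Q (insert B I))"
  shows "(up_sum G B - var B) ^ atom_dist (Sup {y\<in>I. y < B}) B * k \<in> ideal_span (relations G Q I)"
  using k
proof induction
  case (step x g r)
  let ?J = "ideal_span (relations G Q I)"
  let ?u = "up_sum G B - var B"
  let ?d = "atom_dist (Sup {y\<in>I. y < B}) B"
  from step.hyps obtain H C where g: "g = relation_poly G (insert B I) H C"
    and H: "H \<subseteq> Q" "C \<in> Q" "\<forall>h\<in>H. h < C"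
    unfolding relations_def by blast
  have "?u ^ ?d * g \<in> ?J"
  proof (cases "B < C")
    case False
    then have "{y\<in>insert B I. y < C} = {y\<in>I. y < C}" by auto
    then have "g = relation_poly G I H C" by (simp add: g relation_poly_eq)
    then have "g \<in> ?J" using H by (auto simp: relations_def intro!: ideal_span_base)
    then show ?thesis by (rule ideal_span_mult)
  next
    case True
    \<comment> \<open>The variables in this difference belong to elements above \<open>B\<close> but
      not above \<open>C\<close>; by \<open>var_times_relation\<close> each of them carries
      \<open>g\<close> into the ideal for \<open>I\<close>.\<close>
    have "?u - up_sum G C = (\<Sum>D\<in>{D\<in>G. B < D \<and> \<not> C \<le> D}. var D)"
    proof -
      have "up_sum G B = var B + (\<Sum>D\<in>{D\<in>G. B < D}. var D)"
      proof -
        have "{C\<in>G. B \<le> C} = insert B {D\<in>G. B < D}" using B by (auto simp: order_le_less)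
        then show ?thesis by (simp add: up_sum_def)
      qed
      moreover have "(\<Sum>D\<in>{D\<in>G. B < D}. var D)
          = up_sum G C + (\<Sum>D\<in>{D\<in>G. B < D \<and> \<not> C \<le> D}. var D)"
        unfolding up_sum_def using True
        by (subst sum.union_disjoint[symmetric]) (auto intro!: sum.cong)
      ultimately show ?thesis by simp
    qed
    then have "(?u - up_sum G C) * g = (\<Sum>D\<in>{D\<in>G. B < D \<and> \<not> C \<le> D}. var D * g)"
      by (simp add: sum_distrib_right)
    also have "\<dots> \<in> ?J"
      unfolding g by (intro ideal_span_sum var_times_relation H True) auto
    finally have "(?u - up_sum G C) * g \<in> ?J" .
    then have 1: "(?u ^ ?d - up_sum G C ^ ?d) * g \<in> ?J"
      by (rule ideal_span_dvd) (intro mult_dvd_mono diff_dvd_power_diff dvd_refl)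
    have 2: "up_sum G C ^ ?d * g \<in> ?J"
    proof -
      let ?v = "Sup (H \<union> {y\<in>I. y < C})"
      have v: "?v \<le> C" using H(3) by (intro Sup_least) (auto simp: less_imp_le)
      have "sup ?v B = Sup (H \<union> {y\<in>insert B I. y < C})"
      proof -
        have "H \<union> {y\<in>insert B I. y < C} = insert B (H \<union> {y\<in>I. y < C})" using True by auto
        then show ?thesis by (simp add: sup_commute)
      qed
      moreover have "Sup {y\<in>I. y < B} \<le> ?v" using True by (intro Sup_subset_mono) auto
      ultimately have "atom_dist ?v C \<le> atom_dist (Sup (H \<union> {y\<in>insert B I. y < C})) C + ?d"
        using atom_dist_subadd[OF atomic Sup_lt_le, of I B ?v C] True v by simp
      from in_ideal_relations[OF H this, of G] show ?thesis
        unfolding g relation_poly_eq by (simp only: power_add ac_simps)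
    qed
    from ideal_span_add[OF 1 2] show ?thesis by (simp add: algebra_simps)
  qed
  then have "r * (?u ^ ?d * g) + ?u ^ ?d * x \<in> ?J"
    by (intro ideal_span_add[OF ideal_span_mult step.IH])
  then show ?case by (simp add: algebra_simps)
qed simp

end

end

lemma keys_add_single_nat:
  "Poly_Mapping.keys (m + Poly_Mapping.single b i) = Poly_Mapping.keys m \<union> (if i
    = 0 then {} else {b})"
  for m :: "'a \<Rightarrow>\<^sub>0 nat"
  by (auto simp: in_keys_iff lookup_add lookup_single when_def split: if_splits)

lemma minus_add_single:
  "Poly_Mapping.lookup m b = i \<Longrightarrow> m - Poly_Mapping.single b i + Poly_Mapping.single b i = m"
  for m :: "'a \<Rightarrow>\<^sub>0 nat"
  by (rule poly_mapping_eqI) (auto simp: lookup_add lookup_minus lookup_single when_def)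

lemma keys_minus_single:
  "Poly_Mapping.lookup m b = i \<Longrightarrow> Poly_Mapping.keys (m - Poly_Mapping.single b i)
    = Poly_Mapping.keys m - {b}"
  for m :: "'a \<Rightarrow>\<^sub>0 nat"
  by (auto simp: in_keys_iff lookup_minus lookup_single when_def split: if_splits)

lemma ideal_span_mono: "X \<subseteq> Y \<Longrightarrow> ideal_span X \<subseteq> ideal_span Y"
  by (intro ideal_span_minimal ideal_span_base) auto

lemma relations_mono: "Q \<subseteq> Q' \<Longrightarrow> relations G Q I \<subseteq> relations G Q' I"
  unfolding relations_def by blast

section \<open>The induction step: removing a minimal element from an upward closed set\<close>

context overlap_closed
begin

context
  fixes Q B
  assumes B: "B \<in> Q" and Q: "Q \<subseteq> G" and up: "\<And>C D. C \<in> Q \<Longrightarrow> D \<in> G \<Longrightarrow> C \<le> D \<Longrightarrow> D \<in> Q"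
    and minimal: "\<And>C. C \<in> Q \<Longrightarrow> \<not> C < B"
begin

text \<open>By minimality of \<open>B\<close> no variable of \<open>Q\<close> affects the bound at
  \<open>B\<close>. Conversely \<open>B\<close> affects the bounds above it only if it is in the
  support, whence \<open>insert B I\<close> for positive \<open>i\<close> and \<open>I\<close> for
  \<open>i = 0\<close>.\<close>

lemma standard_monomials_split:
  assumes m: "Poly_Mapping.keys m \<subseteq> Q - {B}"
  shows "m + Poly_Mapping.single B i \<in> standard_monomials Q I \<longleftrightarrow>
    i < atom_dist (Sup {y\<in>I. y < B}) B \<and>
    m \<in> standard_monomials (Q - {B}) (if i = 0 then I else insert B I)"
proof -
  let ?n = "m + Poly_Mapping.single B i"
  let ?I = "if i = 0 then I else insert B I"
  have keys: "Poly_Mapping.keys ?n \<subseteq> Q"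
    using m B by (auto simp: keys_add_single_nat)
  have S: "I \<union> Poly_Mapping.keys ?n = ?I \<union> Poly_Mapping.keys m"
    by (auto simp: keys_add_single_nat)
  have SB: "{y \<in> I \<union> Poly_Mapping.keys ?n. y < B} = {y\<in>I. y < B}"
    using keys minimal by auto
  have mB: "Poly_Mapping.lookup m B = 0" using m by (auto simp: in_keys_iff)
  have "?n \<in> standard_monomials Q I \<longleftrightarrow>
      (\<forall>C\<in>insert B (Q - {B}). Poly_Mapping.lookup ?n C < atom_dist (Sup {y \<in> I \<union> Poly_Mapping.keys ?n. y < C}) C)"
    using keys B by (simp add: standard_monomials_def insert_absorb)
  also have "\<dots> \<longleftrightarrow> i < atom_dist (Sup {y\<in>I. y < B}) B \<and>
      (\<forall>C\<in>Q - {B}. Poly_Mapping.lookup m C < atom_dist (Sup {y \<in> ?I \<union> Poly_Mapping.keys m. y < C}) C)"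
  proof -
    have "Poly_Mapping.lookup ?n C = Poly_Mapping.lookup m C" if "C \<in> Q - {B}" for C
      using that by (auto simp: lookup_add lookup_single)
    then have "Poly_Mapping.lookup ?n C < atom_dist (Sup {y \<in> I \<union> Poly_Mapping.keys ?n. y < C}) C \<longleftrightarrow>
        Poly_Mapping.lookup m C < atom_dist (Sup {y \<in> ?I \<union> Poly_Mapping.keys m. y < C}) C"
      if "C \<in> Q - {B}" for C
      using that by (simp only: S)
    moreover have "Poly_Mapping.lookup ?n B < atom_dist (Sup {y \<in> I \<union> Poly_Mapping.keys ?n. y < B}) B \<longleftrightarrow>
        i < atom_dist (Sup {y\<in>I. y < B}) B"
      unfolding SB by (simp add: lookup_add mB)
    ultimately show ?thesis by blast
  qed
  finally show ?thesis using m by (simp add: standard_monomials_def)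
qed

lemma above_in: "C \<in> G \<Longrightarrow> B < C \<Longrightarrow> C \<in> Q - {B}"
  using up[OF B] by (auto simp: less_imp_le)

lemma rest_sub: "Q - {B} \<subseteq> G"
  using Q by auto

lemma up_sum_minus_var: "up_sum G B - var B = (\<Sum>C\<in>{C\<in>G. B < C}. var C)"
proof -
  have "{C\<in>G. B \<le> C} = insert B {C\<in>G. B < C}" using B Q by (auto simp: order_le_less)
  then show ?thesis by (simp add: up_sum_def)
qed

lemma up_sum_polys_in: "C \<in> Q \<Longrightarrow> C \<noteq> B \<Longrightarrow> up_sum G C \<in> polys_in (- {B})"
  unfolding up_sum_def
proof (intro polys_in_sum polys_in_var)
  fix D assume "C \<in> Q" "C \<noteq> B" "D \<in> {D\<in>G. C \<le> D}"
  then show "D \<in> - {B}" using minimal[of C] by (auto simp: order_le_less)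
qed

lemma split_var_up_sum: "split_var B (up_sum G B) = [:up_sum G B - var B, 1:]"
proof -
  have "up_sum G B - var B \<in> polys_in (- {B})"
    unfolding up_sum_minus_var by (intro polys_in_sum polys_in_var) auto
  then have "split_var B (up_sum G B - var B) = [:up_sum G B - var B:]"
    by (rule split_var_const)
  then have "split_var B ((up_sum G B - var B) + var B) = [:up_sum G B - var B:] + [:0, 1:]"
    unfolding split_var_add by (simp only: split_var_var)
  then show ?thesis by simp
qed

text \<open>This brings the ideal into the form required by \<open>adjoin_root_coeffs\<close>. A
  relation with target \<open>B\<close> has empty \<open>H\<close> and becomes the power of the
  linear polynomial; one without \<open>B\<close> is a constant; one with \<open>B\<close> in
  \<open>H\<close> is the variable times a relation for \<open>insert B I\<close>.\<close>

lemma split_var_relations: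
  assumes "p \<in> ideal_span (relations G Q I)"
  shows "\<exists>a b. split_var B p = a + [:up_sum G B - var B, 1:] ^ atom_dist (Sup {y\<in>I. y < B}) B * b \<and>
    coeff a 0 \<in> ideal_span (relations G (Q - {B}) I) \<and>
    (\<forall>i. coeff a i \<in> ideal_span (relations G (Q - {B}) (insert B I)))"
  using assms
proof induction
  case zero
  show ?case by (intro exI[of _ 0]) auto
next
  case (step x g r)
  let ?J = "ideal_span (relations G (Q - {B}) I)"
  let ?K = "ideal_span (relations G (Q - {B}) (insert B I))"
  let ?d = "atom_dist (Sup {y\<in>I. y < B}) B"
  let ?f = "[:up_sum G B - var B, 1:] ^ ?d"
  from step.IH obtain a b where ab: "split_var B x = a + ?f * b" "coeff a 0 \<in> ?J"
    "\<And>i. coeff a i \<in> ?K"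
    by blast
  from step.hyps obtain H C where g: "g = relation_poly G I H C" and H: "H \<subseteq> Q" "C \<in> Q"
    "\<forall>h\<in>H. h < C"
    unfolding relations_def by blast
  have "\<exists>a b. split_var B g = a + ?f * b \<and> coeff a 0 \<in> ?J \<and> (\<forall>i. coeff a i \<in> ?K)"
  proof -
    consider "C = B" | "C \<noteq> B" "B \<notin> H" | "C \<noteq> B" "B \<in> H" by blast
    then show ?thesis
    proof cases
      case 1
      then have "H = {}" using H minimal by auto
      then have "split_var B g = ?f"
        by (simp add: g relation_poly_eq 1 split_var_def poly_eval_power flip: split_var_up_sum)
      then show ?thesis by (intro exI[of _ 0] exI[of _ 1]) auto
    next
      case 2
      have "g \<in> polys_in (- {B})"
        unfolding g relation_poly_eq using 2 H
        by (intro polys_in_mult polys_in_prod polys_in_power up_sum_polys_in polys_in_var) auto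
      then have "split_var B g = [:g:] + ?f * 0" by (simp add: split_var_const)
      moreover have "g \<in> ?J" using H 2 unfolding g relations_def by (intro ideal_span_base) blast
      moreover have "g \<in> ?K" using calculation ideal_relations_insert by blast
      ultimately show ?thesis
        by (intro exI[of _ "[:g:]"] exI[of _ 0]) (auto simp: coeff_pCons split: nat.split)
    next
      case 3
      let ?g = "relation_poly G (insert B I) (H - {B}) C"
      have "H \<union> {y\<in>I. y < C} = (H - {B}) \<union> {y\<in>insert B I. y < C}" using 3 H by auto
      moreover have "(\<Prod>A\<in>H. var A) = var B * (\<Prod>A\<in>H - {B}. var A)"
        using 3 by (intro prod.remove) auto
      ultimately have "g = var B * ?g"
        unfolding g relation_poly_eq by (simp only: mult.assoc)
      moreover have "?g \<in> polys_in (- {B})"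
        unfolding g relation_poly_eq using 3 H
        by (intro polys_in_mult polys_in_prod polys_in_power up_sum_polys_in polys_in_var) auto
      ultimately have "split_var B g = [:0, 1:] * [:?g:] + ?f * 0"
        by (simp add: split_var_mult split_var_var split_var_const)
      moreover have "?g \<in> ?K" using H 3 unfolding relations_def by (intro ideal_span_base) blast
      ultimately show ?thesis
        by (intro exI[of _ "[:0, 1:] * [:?g:]"] exI[of _ 0]) (auto simp: coeff_pCons split: nat.split)
    qed
  qed
  then obtain a' b' where ab': "split_var B g = a' + ?f * b'" "coeff a' 0 \<in> ?J"
    "\<And>i. coeff a' i \<in> ?K"
    by blast
  let ?r = "split_var B r"
  have "split_var B (r * g + x) = (?r * a' + a) + ?f * (?r * b' + b)"
    by (simp add: split_var_add split_var_mult ab ab' algebra_simps)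
  moreover have "coeff (?r * a' + a) 0 \<in> ?J"
    by (simp add: coeff_mult_0 ideal_span_add ideal_span_mult ab ab')
  moreover have "coeff (?r * a' + a) i \<in> ?K" for i
    unfolding coeff_add coeff_mult
    by (intro ideal_span_add ab ideal_span_sum ideal_span_mult ab')
  ultimately show ?case by blast
qed

text \<open>The coefficients of \<open>p\<close> in \<open>var B\<close> are combinations of smaller
  standard monomials and vanish from degree \<open>?d\<close> on. By
  \<open>adjoin_root_coeffs\<close> the constant one lies in the ideal for \<open>I\<close> and the
  others in that for \<open>insert B I\<close>, so the induction hypothesis makes them 0.\<close>

lemma standard_independent_step:
  assumes IH: "\<And>I p. Poly_Mapping.keys p \<subseteq> standard_monomials (Q - {B}) I \<Longrightarrow>
      p \<in> ideal_span (relations G (Q - {B}) I) \<Longrightarrow> p = 0"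
    and keys: "Poly_Mapping.keys p \<subseteq> standard_monomials Q I"
    and p: "p \<in> ideal_span (relations G Q I)"
  shows "p = 0"
proof -
  let ?J = "ideal_span (relations G (Q - {B}) I)"
  let ?K = "ideal_span (relations G (Q - {B}) (insert B I))"
  let ?d = "atom_dist (Sup {y\<in>I. y < B}) B"
  let ?c = "\<lambda>i. coeff (split_var B p) i"
  have c: "i < ?d \<and> k \<in> standard_monomials (Q - {B}) (if i = 0 then I else insert B I)"
    if k: "k \<in> Poly_Mapping.keys (?c i)" for i k
  proof -
    obtain m where m: "m \<in> Poly_Mapping.keys p" "Poly_Mapping.lookup m B = i" "k
      = m - Poly_Mapping.single B i"
      using keys_coeff_split_var[of B p i] k by auto
    then have "m \<in> standard_monomials Q I" using keys by auto
    then have "Poly_Mapping.keys k \<subseteq> Q - {B}" "k + Poly_Mapping.single B i \<in> standard_monomials Q I"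
      using m by (auto simp: keys_minus_single minus_add_single standard_monomials_def)
    then show ?thesis using standard_monomials_split by blast
  qed
  obtain a b where ab: "split_var B p = a + [:up_sum G B - var B, 1:] ^ ?d * b"
    "coeff a 0 \<in> ?J" "\<And>i. coeff a i \<in> ?K"
    using split_var_relations[OF p] by blast
  have deg: "?c i = 0" if "?d \<le> i" for i
    using c[of _ i] that by (metis ex_in_conv keys_eq_empty not_le)
  have kill: "(up_sum G B - var B) ^ ?d * k \<in> ?J" if "k \<in> ?K" for k
    using B Q by (intro relation_times_power[OF _ rest_sub above_in that]) auto
  have "?c 0 \<in> ?J" and "?c i \<in> ?K" for i
    using adjoin_root_coeffs[OF ab(2,3) ideal_relations_insert kill deg[unfolded ab(1)]]
    unfolding ab(1) by auto
  then have "?c i = 0" for i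
    using c[of _ i] by (cases "i = 0") (auto intro!: IH)
  then have "split_var B p = 0" by (intro poly_eqI) simp
  then show ?thesis using poly_split_var[of B p] by simp
qed

text \<open>Powers of \<open>var B\<close> from \<open>?d\<close> on are lowered by the relation
  with target \<open>B\<close>. Below \<open>?d\<close>, the coefficients are reduced by the
  induction hypothesis, for \<open>I\<close> in degree 0 and for \<open>insert B I\<close> in
  positive degrees.\<close>

lemma standard_spanning_step:
  assumes IH: "\<And>I p. p \<in> polys_in (Q - {B}) \<Longrightarrow> \<exists>s. Poly_Mapping.keys s
    \<subseteq> standard_monomials (Q - {B}) I \<and>
      p - s \<in> ideal_span (relations G (Q - {B}) I)"
    and p: "p \<in> polys_in Q"
  shows "\<exists>s. Poly_Mapping.keys s \<subseteq> standard_monomials Q I \<and> p - s \<in> ideal_span (relations G Q I)"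
proof -
  let ?J = "ideal_span (relations G Q I)"
  let ?d = "atom_dist (Sup {y\<in>I. y < B}) B"
  let ?u = "up_sum G B - var B"
  \<comment> \<open>The polynomials with a standard representative; they contain the ideal and are
    closed under sums.\<close>
  define R where "R = {p. \<exists>s. Poly_Mapping.keys s \<subseteq> standard_monomials Q I \<and> p - s \<in> ?J}"
  have R_I: "p \<in> R" if "Poly_Mapping.keys s \<subseteq> standard_monomials Q I" "p - s \<in> ?J" for p s
    using that by (auto simp: R_def)
  have R_add: "p + q \<in> R" if p: "p \<in> R" and q: "q \<in> R" for p q
  proof -
    obtain s where s: "Poly_Mapping.keys s \<subseteq> standard_monomials Q I" "p - s \<in> ?J"
      using p by (auto simp: R_def)
    obtain t where t: "Poly_Mapping.keys t \<subseteq> standard_monomials Q I" "q - t \<in> ?J"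
      using q by (auto simp: R_def)
    have "(p + q) - (s + t) = (p - s) + (q - t)" by simp
    then have "(p + q) - (s + t) \<in> ?J" using ideal_span_add[OF s(2) t(2)] by (simp only:)
    moreover have "Poly_Mapping.keys (s + t) \<subseteq> standard_monomials Q I"
      using keys_add[of s t] s(1) t(1) by (meson Un_least order_trans)
    ultimately show ?thesis by (intro R_I)
  qed
  have R_J: "p \<in> R" if "p \<in> ?J" for p
    using that by (intro R_I[of 0]) auto
  have R_sum: "sum f A \<in> R" if "\<And>i. i \<in> A \<Longrightarrow> f i \<in> R" for f :: "nat \<Rightarrow> _" and A
    using that by (induction A rule: infinite_finite_induct) (auto intro: R_add R_J)
  have sub: "ideal_span (relations G (Q - {B}) I) \<subseteq> ?J"
    by (intro ideal_span_mono relations_mono) auto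
  \<comment> \<open>A factor \<open>var B\<close> moves \<open>B\<close> from the index set into
    \<open>H\<close>, turning a relation for \<open>insert B I\<close> with target above
    \<open>B\<close> into one for \<open>I\<close>.\<close>
  have subK: "var B * k \<in> ?J" if "k \<in> ideal_span (relations G (Q - {B}) (insert B I))" for k
    using that
  proof induction
    case (step x g r)
    then obtain H C where g: "g = relation_poly G (insert B I) H C"
      and H: "H \<subseteq> Q - {B}" "C \<in> Q - {B}" "\<forall>h\<in>H. h < C"
      unfolding relations_def by blast
    have "var B * g \<in> ?J"
    proof (cases "B < C")
      case True
      have "H \<union> {y\<in>insert B I. y < C} = insert B H \<union> {y\<in>I. y < C}" using True by auto
      moreover have "(\<Prod>A\<in>insert B H. var A) = var B * (\<Prod>A\<in>H. var A)"
        using H by (intro prod.insert) auto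
      ultimately have "var B * g = relation_poly G I (insert B H) C"
        unfolding g relation_poly_eq by (simp only: mult.assoc)
      moreover have "relation_poly G I (insert B H) C \<in> relations G Q I"
        unfolding relations_def using H B True by blast
      ultimately show ?thesis by (simp add: ideal_span_base)
    next
      case False
      then have "{y\<in>insert B I. y < C} = {y\<in>I. y < C}" by auto
      then have "g = relation_poly G I H C" unfolding g relation_poly_eq by (simp only:)
      then have "g \<in> relations G Q I" using H unfolding relations_def by blast
      then show ?thesis by (intro ideal_span_mult ideal_span_base)
    qed
    then have "r * (var B * g) + var B * x \<in> ?J"
      by (intro ideal_span_add[OF ideal_span_mult step.IH])
    then show ?case by (simp add: algebra_simps)
  qed simp
  have f: "up_sum G B ^ ?d \<in> ?J"
    using in_ideal_relations[of "{}" Q B I ?d G] B by simp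
  have u: "?u \<in> polys_in (Q - {B})"
    unfolding up_sum_minus_var by (intro polys_in_sum polys_in_var above_in) auto
  have main: "var B ^ i * q \<in> R" if "q \<in> polys_in (Q - {B})" for i q
    using that
  proof (induction i arbitrary: q rule: less_induct)
    case (less i)
    show ?case
    proof (cases "i < ?d")
      case True
      let ?I = "if i = 0 then I else insert B I"
      obtain s where s: "Poly_Mapping.keys s \<subseteq> standard_monomials (Q - {B}) ?I"
        "q - s \<in> ideal_span (relations G (Q - {B}) ?I)"
        using IH[OF less.prems] by blast
      show ?thesis
      proof (rule R_I)
        show "Poly_Mapping.keys (var B ^ i * s) \<subseteq> standard_monomials Q I"
        proof
          fix k assume "k \<in> Poly_Mapping.keys (var B ^ i * s)"
          then obtain m where m: "m \<in> Poly_Mapping.keys s" "k = m + Poly_Mapping.single B i"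
            using keys_mult[of "var B ^ i" s] by (auto simp: var_power monomial_def add.commute)
          then have "m \<in> standard_monomials (Q - {B}) ?I" using s(1) by blast
          moreover from this have "Poly_Mapping.keys m \<subseteq> Q - {B}"
            by (simp add: standard_monomials_def)
          ultimately show "k \<in> standard_monomials Q I"
            unfolding m(2) using True standard_monomials_split by blast
        qed
        have "var B ^ i * (q - s) \<in> ?J"
        proof (cases i)
          case 0
          then show ?thesis using s(2) sub by auto
        next
          case (Suc j)
          then have "var B * (q - s) \<in> ?J" using s(2) by (intro subK) simp
          then have "var B ^ j * (var B * (q - s)) \<in> ?J" by (rule ideal_span_mult)
          then show ?thesis by (simp add: Suc ac_simps)
        qed
        then show "var B ^ i * q - var B ^ i * s \<in> ?J" by (simp add: right_diff_distrib)
      qed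
    next
      case False
      \<comment> \<open>These are the binomial terms of \<open>(var B + ?u) ^ ?d\<close> times
        \<open>var B ^ (i - ?d) * q\<close>. The term \<open>j = ?d\<close> is the polynomial to be
        reduced, and all others have a smaller exponent of \<open>var B\<close>.\<close>
      let ?t = "\<lambda>j. var B ^ (i - ?d + j) * (of_nat (?d choose j) * ?u ^ (?d - j) * q)"
      have "up_sum G B ^ ?d = (var B + ?u) ^ ?d" by simp
      also have "\<dots> = (\<Sum>j\<le>?d. of_nat (?d choose j) * var B ^ j * ?u ^ (?d - j))"
        by (rule binomial_ring)
      finally have "var B ^ (i - ?d) * q * up_sum G B ^ ?d = (\<Sum>j\<le>?d. ?t j)"
        by (simp add: sum_distrib_left power_add ac_simps)
      also have "\<dots> = (\<Sum>j<?d. ?t j) + var B ^ i * q"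
        using False by (simp flip: lessThan_Suc_atMost)
      finally have eq: "var B ^ i * q = var B ^ (i - ?d) * q * up_sum G B ^ ?d + (\<Sum>j<?d. - ?t j)"
        by (simp add: sum_negf)
      have "- ?t j \<in> R" if "j \<in> {..<?d}" for j
      proof -
        have "var B ^ (i - ?d + j) * - (of_nat (?d choose j) * ?u ^ (?d - j) * q) \<in> R"
          using that False
          by (intro less.IH polys_in_uminus polys_in_mult polys_in_of_nat polys_in_power u less.prems) auto
        then show ?thesis by simp
      qed
      then show ?thesis
        unfolding eq by (intro R_add[OF R_J[OF ideal_span_mult[OF f]] R_sum])
    qed
  qed
  have "p = (\<Sum>i\<le>degree (split_var B p). var B ^ i * coeff (split_var B p) i)"
    using poly_split_var[of B p] by (simp add: poly_altdef mult.commute)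
  also have "\<dots> \<in> R"
  proof (intro R_sum main)
    fix i
    have "Poly_Mapping.keys k \<subseteq> Q - {B}" if "k \<in> Poly_Mapping.keys (coeff (split_var B p) i)" for k
      using keys_coeff_split_var[of B p i] that p by (force simp: keys_minus_single polys_in_def)
    then show "coeff (split_var B p) i \<in> polys_in (Q - {B})" by (simp add: polys_in_def)
  qed
  finally show ?thesis by (auto simp: R_def)
qed

end

text \<open>Induction on the size of \<open>Q\<close>, removing a minimal element each time.
  \<open>I\<close> is generalised because the step also uses the claim for
  \<open>insert B I\<close>; for empty \<open>Q\<close> there are no relations and only
  constants.\<close>

lemma standard_independent_spanning:
  assumes "Q \<subseteq> G" and "\<forall>C\<in>Q. \<forall>D\<in>G. C \<le> D \<longrightarrow> D \<in> Q"
  shows "(Poly_Mapping.keys p \<subseteq> standard_monomials Q I \<longrightarrow> p \<in> ideal_span (relations G Q I) \<longrightarrow> p = 0) \<and>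
    (q \<in> polys_in Q \<longrightarrow>
      (\<exists>s. Poly_Mapping.keys s \<subseteq> standard_monomials Q I \<and> q - s \<in> ideal_span (relations G Q I)))"
  using assms
proof (induction "card Q" arbitrary: Q I p q rule: less_induct)
  case less
  show ?case
  proof (cases "Q = {}")
    case True
    have 1: "p = 0" if "p \<in> ideal_span (relations G {} I)"
      using that by induction (auto simp: relations_def)
    have 2: "Poly_Mapping.keys q \<subseteq> standard_monomials {} I" if "q \<in> polys_in {}"
      using that by (auto simp: polys_in_def standard_monomials_def)
    have "\<exists>s. Poly_Mapping.keys s \<subseteq> standard_monomials {} I \<and> q - s \<in> ideal_span (relations G {} I)"
      if "q \<in> polys_in {}"
      using 2[OF that] by (intro exI[of _ q]) simp
    then show ?thesis using True 1 by blast
  next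
    case False
    then obtain B where B: "B \<in> Q" "\<forall>C\<in>Q. C \<le> B \<longrightarrow> B = C"
      using finite_has_minimal[of Q] by auto
    have card: "card (Q - {B}) < card Q"
      using B by (intro card_Diff1_less) auto
    have up: "\<And>C D. C \<in> Q \<Longrightarrow> D \<in> G \<Longrightarrow> C \<le> D \<Longrightarrow> D \<in> Q"
      using less.prems(2) by blast
    have up': "\<forall>C\<in>Q - {B}. \<forall>D\<in>G. C \<le> D \<longrightarrow> D \<in> Q - {B}"
      using less.prems(2) B by blast
    have sub': "Q - {B} \<subseteq> G" using less.prems(1) by auto
    note IH = less.hyps[OF card sub' up']
    have min: "\<And>C. C \<in> Q \<Longrightarrow> \<not> C < B" using B(2) by (auto simp: less_le)
    \<comment> \<open>The two halves are separated by putting 0 for the polynomial of the other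
      half.\<close>
    have indep: "r = 0" if "Poly_Mapping.keys r \<subseteq> standard_monomials (Q - {B}) J"
      "r \<in> ideal_span (relations G (Q - {B}) J)" for r J
      using IH[where p = r and I = J and q = 0] that by blast
    have span: "\<exists>s. Poly_Mapping.keys s \<subseteq> standard_monomials (Q - {B}) J \<and>
        r - s \<in> ideal_span (relations G (Q - {B}) J)" if "r \<in> polys_in (Q - {B})" for r J
      using IH[where p = 0 and I = J and q = r] that by blast
    show ?thesis
    proof (intro conjI impI)
      assume "Poly_Mapping.keys p \<subseteq> standard_monomials Q I" "p \<in> ideal_span (relations G Q I)"
      with B(1) less.prems(1) up min indep show "p = 0"
        by (rule standard_independent_step)
    next
      assume "q \<in> polys_in Q"
      with B(1) less.prems(1) up min span
      show "\<exists>s. Poly_Mapping.keys s \<subseteq> standard_monomials Q I \<and> q - s \<in> ideal_span (relations G Q I)"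
        by (rule standard_spanning_step)
    qed
  qed
qed

end

section \<open>The rank of the quotient ring\<close>

lemma zpoly_ring_simps [simp]:
  "carrier (zpoly_ring V) = polys_in V"
  "p \<otimes>\<^bsub>zpoly_ring V\<^esub> q = p * q"
  "p \<oplus>\<^bsub>zpoly_ring V\<^esub> q = p + q"
  "\<one>\<^bsub>zpoly_ring V\<^esub> = 1"
  "\<zero>\<^bsub>zpoly_ring V\<^esub> = 0"
  by (simp_all add: zpoly_ring_def polys_in_def)

lemma cring_zpoly_ring: "cring (zpoly_ring V)"
proof (rule cringI)
  show "abelian_group (zpoly_ring V)"
  proof (rule abelian_groupI)
    fix p assume "p \<in> carrier (zpoly_ring V)"
    then show "\<exists>q\<in>carrier (zpoly_ring V). q \<oplus>\<^bsub>zpoly_ring V\<^esub> p = \<zero>\<^bsub>zpoly_ring V\<^esub>"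
      by (intro bexI[of _ "- p"]) (auto intro: polys_in_uminus)
  qed (auto intro: polys_in_add)
  show "Group.comm_monoid (zpoly_ring V)"
    by (rule comm_monoidI) (auto intro: polys_in_mult simp: mult.assoc mult.commute)
qed (auto simp: distrib_right)

interpretation zpoly: cring "zpoly_ring V" for V
  by (rule cring_zpoly_ring)

lemma zpoly_a_inv: "p \<in> polys_in V \<Longrightarrow> \<ominus>\<^bsub>zpoly_ring V\<^esub> p = - p"
  using zpoly.minus_equality[where V = V and y = "- p" and x = p] by (simp add: polys_in_uminus)

lemma zpoly_a_minus: "q \<in> polys_in V \<Longrightarrow> p \<ominus>\<^bsub>zpoly_ring V\<^esub> q = p - q"
  by (simp add: a_minus_def zpoly_a_inv)

lemma zpoly_add_pow:
  assumes "p \<in> polys_in V" shows "[(k::int)] \<cdot>\<^bsub>zpoly_ring V\<^esub> p = of_int k * p"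
proof -
  have nat: "[(n::nat)] \<cdot>\<^bsub>zpoly_ring V\<^esub> p = of_nat n * p" for n
    by (induction n) (auto simp: zpoly.add.nat_pow_0 zpoly.add.nat_pow_Suc assms algebra_simps)
  show ?thesis
  proof (cases "k \<ge> 0")
    case True
    then show ?thesis by (simp add: add_pow_int_ge nat)
  next
    case False
    have "of_nat (nat (- k)) * p \<in> polys_in V" by (intro polys_in_mult polys_in_of_nat assms)
    then show ?thesis using False by (simp add: add_pow_int_lt nat zpoly_a_inv)
  qed
qed

lemma relation_poly_in_polys_in:
  "H \<subseteq> G \<Longrightarrow> relation_poly G I H C \<in> polys_in G"
  unfolding relation_poly_eq up_sum_def
  by (intro polys_in_mult polys_in_prod polys_in_power polys_in_sum polys_in_var) auto

lemma relation_ideal_eq: "relation_ideal G I = Idl\<^bsub>zpoly_ring G\<^esub> (relations G G I)"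
  unfolding relation_ideal_def relations_def ..

lemma relations_in_polys_in: "relations G G I \<subseteq> polys_in G"
  using relation_poly_in_polys_in unfolding relations_def by blast

lemma ideal_relation_ideal: "ideal (relation_ideal G I) (zpoly_ring G)"
  unfolding relation_ideal_eq by (rule zpoly.genideal_ideal) (simp add: relations_in_polys_in)

text \<open>The ideal in the smaller ring is the trace of the one in the full polynomial ring, by the
  retraction that sends the variables outside \<open>G\<close> to 0.\<close>

lemma mem_relation_ideal_iff:
  assumes p: "p \<in> polys_in G"
  shows "p \<in> relation_ideal G I \<longleftrightarrow> p \<in> ideal_span (relations G G I)"
proof
  let ?S = "polys_in G \<inter> ideal_span (relations G G I)"
  have right: "x * y \<in> ideal_span (relations G G I)" if "x \<in> ideal_span (relations G G I)" for x y
    using ideal_span_mult[OF that, of y] by (simp add: mult.commute)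
  have "ideal ?S (zpoly_ring G)"
  proof (rule idealI[OF zpoly.ring_axioms])
    show "subgroup ?S (add_monoid (zpoly_ring G))"
    proof
      fix x assume x: "x \<in> ?S"
      then have "inv\<^bsub>add_monoid (zpoly_ring G)\<^esub> x = - x"
        using zpoly_a_inv by (auto simp: a_inv_def)
      then show "inv\<^bsub>add_monoid (zpoly_ring G)\<^esub> x \<in> ?S"
        using x by (auto intro: polys_in_uminus ideal_span_uminus)
    qed (auto intro: polys_in_add ideal_span_add)
  qed (auto intro: polys_in_mult ideal_span_mult right)
  then have "relation_ideal G I \<subseteq> ?S"
    unfolding relation_ideal_eq
    using relations_in_polys_in by (intro zpoly.genideal_minimal) (auto intro: ideal_span_base)
  then show "p \<in> relation_ideal G I \<Longrightarrow> p \<in> ideal_span (relations G G I)" by blast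
next
  assume "p \<in> ideal_span (relations G G I)"
  let ?\<rho> = "poly_eval (\<lambda>a. if a \<in> G then var a else 0)"
  have \<rho>: "?\<rho> q \<in> polys_in G" for q
    by (rule poly_eval_in_polys_in) (auto intro: polys_in_var)
  have \<rho>_id: "?\<rho> q = q" if "q \<in> polys_in G" for q
    using poly_eval_cong[OF that, of "\<lambda>a. if a \<in> G then var a else 0" var]
      by (simp add: poly_eval_of_var)
  interpret ideal "relation_ideal G I" "zpoly_ring G" by (rule ideal_relation_ideal)
  \<comment> \<open>The multipliers \<open>r\<close> may involve variables outside \<open>G\<close>,
    so the induction is about images under \<open>?\<rho>\<close>, which fixes the generators and
    finally \<open>p\<close>.\<close>
  from \<open>p \<in> ideal_span (relations G G I)\<close> have "?\<rho> p \<in> relation_ideal G I"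
  proof induction
    case zero
    then show ?case using zero_closed by simp
  next
    case (step x g r)
    have "g \<in> relation_ideal G I"
      using step.hyps zpoly.genideal_self[of "relations G G I" G] relations_in_polys_in
      unfolding relation_ideal_eq by auto
    then have "?\<rho> r * g \<in> relation_ideal G I"
      using I_l_closed[of g "?\<rho> r"] \<rho> by simp
    then have "?\<rho> r * g + ?\<rho> x \<in> relation_ideal G I"
      using a_closed step.IH by simp
    moreover have "?\<rho> g = g" using step.hyps relations_in_polys_in by (intro \<rho>_id) auto
    ultimately show ?case by (simp add: poly_eval_add poly_eval_mult)
  qed
  then show "p \<in> relation_ideal G I" using \<rho>_id[OF p] by simp
qed

section \<open>Residue classes and their integer combinations\<close>

definition residue_class where
  "residue_class G I p = relation_ideal G I +>\<^bsub>zpoly_ring G\<^esub> p"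

lemma cring_D_ring: "cring (D_ring G I)"
  unfolding D_ring_def by (rule ideal.quotient_is_cring[OF ideal_relation_ideal cring_zpoly_ring])

interpretation D: cring "D_ring G I" for G I
  by (rule cring_D_ring)

lemma residue_class_hom: "ring_hom_ring (zpoly_ring G) (D_ring G I) (residue_class G I)"
  unfolding D_ring_def residue_class_def
  by (rule ideal.rcos_ring_hom_ring[OF ideal_relation_ideal])

lemma carrier_D_ring: "carrier (D_ring G I) = residue_class G I ` polys_in G"
  unfolding D_ring_def FactRing_simps residue_class_def by auto

lemma residue_class_eq_iff:
  assumes "p \<in> polys_in G" "q \<in> polys_in G"
  shows "residue_class G I p = residue_class G I q \<longleftrightarrow> p - q \<in> ideal_span (relations G G I)"
proof -
  have "residue_class G I p = residue_class G I q \<longleftrightarrow> p - q \<in> relation_ideal G I"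
    using zpoly.quotient_eq_iff_same_a_r_cos[OF ideal_relation_ideal, of p G q I] assms
    unfolding residue_class_def by (simp add: zpoly_a_minus)
  then show ?thesis using assms by (simp add: mem_relation_ideal_iff polys_in_diff)
qed

lemma residue_class_add_pow:
  assumes "p \<in> polys_in G"
  shows "[(k::int)] \<cdot>\<^bsub>D_ring G I\<^esub> residue_class G I p = residue_class G I (of_int k * p)"
proof -
  interpret h: ring_hom_ring "zpoly_ring G" "D_ring G I" "residue_class G I"
    by (rule residue_class_hom)
  have "[k] \<cdot>\<^bsub>D_ring G I\<^esub> residue_class G I p = residue_class G I ([k] \<cdot>\<^bsub>zpoly_ring G\<^esub> p)"
    using group_hom.hom_int_pow[OF h.a_group_hom, of p k] assms by (simp add: add_pow_def)
  then show ?thesis by (simp add: zpoly_add_pow assms)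
qed

lemma residue_class_lincomb:
  assumes "finite X" and "\<And>x. x \<in> X \<Longrightarrow> f x \<in> polys_in G"
  shows "(\<Oplus>\<^bsub>D_ring G I\<^esub>x\<in>X. [(c x :: int)] \<cdot>\<^bsub>D_ring G I\<^esub> residue_class G I (f x)) =
    residue_class G I (\<Sum>x\<in>X. of_int (c x) * f x)"
  using assms
proof (induction X rule: finite_induct)
  case empty
  interpret h: ring_hom_ring "zpoly_ring G" "D_ring G I" "residue_class G I"
    by (rule residue_class_hom)
  show ?case using h.hom_zero by simp
next
  case (insert y X)
  interpret h: ring_hom_ring "zpoly_ring G" "D_ring G I" "residue_class G I"
    by (rule residue_class_hom)
  have p: "of_int (c x) * f x \<in> polys_in G" if "x \<in> insert y X" for x
    using insert.prems[OF that] by (intro polys_in_mult polys_in_of_int)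
  have "[c x] \<cdot>\<^bsub>D_ring G I\<^esub> residue_class G I (f x) \<in> carrier (D_ring G I)" if "x \<in> insert y X"
    for x
    using p[OF that] insert.prems[OF that] by (simp add: residue_class_add_pow carrier_D_ring)
  then have "(\<Oplus>\<^bsub>D_ring G I\<^esub>x\<in>insert y X. [c x] \<cdot>\<^bsub>D_ring G I\<^esub> residue_class G I (f x)) =
      [c y] \<cdot>\<^bsub>D_ring G I\<^esub> residue_class G I (f y) \<oplus>\<^bsub>D_ring G I\<^esub> residue_class G I (\<Sum>x\<in>X. of_int (c x) * f x)"
    using insert by (subst D.finsum_insert) auto
  also have "\<dots> = residue_class G I (of_int (c y) * f y + (\<Sum>x\<in>X. of_int (c x) * f x))"
    using h.hom_add[of "of_int (c y) * f y" "\<Sum>x\<in>X. of_int (c x) * f x"] p insert.prems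
    by (simp add: residue_class_add_pow polys_in_sum)
  finally show ?case using insert.hyps by simp
qed

text \<open>Gaussian elimination without division: a pivot \<open>z\<close> with
  \<open>a z k\<close> nonzero clears coordinate \<open>k\<close> from the other vectors after these
  are scaled by \<open>a z k\<close>.\<close>

lemma int_linear_dependence:
  fixes a :: "'x \<Rightarrow> 'n \<Rightarrow> int"
  assumes "finite N" "finite X" "card N < card X"
  shows "\<exists>c. (\<exists>x\<in>X. c x \<noteq> 0) \<and> (\<forall>n\<in>N. (\<Sum>x\<in>X. c x * a x n) = 0)"
  using assms
proof (induction N arbitrary: X a rule: finite_induct)
  case empty
  then have "X \<noteq> {}" by auto
  then show ?case by (intro exI[of _ "\<lambda>_. 1"]) auto
next
  case (insert k N)
  show ?case
  proof (cases "\<forall>x\<in>X. a x k = 0")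
    case True
    obtain c where "\<exists>x\<in>X. c x \<noteq> 0" "\<forall>n\<in>N. (\<Sum>x\<in>X. c x * a x n) = 0"
      using insert.IH[of X a] insert.prems insert.hyps by auto
    then show ?thesis using True by (intro exI[of _ c]) auto
  next
    case False
    then obtain z where z: "z \<in> X" "a z k \<noteq> 0" by blast
    have "card N < card (X - {z})"
      using insert.prems insert.hyps z by simp
    from insert.IH[OF _ this, of "\<lambda>x n. a z k * a x n - a x k * a z n"]
    obtain c where c: "\<exists>x\<in>X - {z}. c x \<noteq> 0"
      "\<And>n. n \<in> N \<Longrightarrow> (\<Sum>x\<in>X - {z}. c x * (a z k * a x n - a x k * a z n)) = 0"
      using insert.prems by blast
    \<comment> \<open>The dependence of the eliminated vectors, rewritten in the original ones. It
      stays nontrivial because \<open>a z k\<close> is nonzero.\<close>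
    define d where "d = (\<lambda>x. if x = z then - (\<Sum>x\<in>X - {z}. c x * a x k) else a z k * c x)"
    have dz: "d z = - (\<Sum>x\<in>X - {z}. c x * a x k)" by (simp add: d_def)
    have d: "(\<Sum>x\<in>X. d x * a x n) = (\<Sum>x\<in>X - {z}. c x * (a z k * a x n - a x k * a z n))" for n
    proof -
      have "(\<Sum>x\<in>X. d x * a x n) = d z * a z n + (\<Sum>x\<in>X - {z}. d x * a x n)"
        using insert.prems z by (intro sum.remove) auto
      also have "(\<Sum>x\<in>X - {z}. d x * a x n) = (\<Sum>x\<in>X - {z}. a z k * c x * a x n)"
        by (rule sum.cong) (auto simp: d_def)
      finally show ?thesis
        by (simp add: dz sum_distrib_left sum_subtractf right_diff_distrib ac_simps)
    qed
    have "(\<Sum>x\<in>X. d x * a x n) = 0" if "n \<in> insert k N" for n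
      using that c(2) unfolding d by (auto simp: mult.commute)
    moreover have "\<exists>x\<in>X. d x \<noteq> 0" using c(1) z(2) by (auto simp: d_def)
    ultimately show ?thesis by blast
  qed
qed

text \<open>A distance is the size of a set of atoms, so all exponents are bounded by the size of
  the lattice.\<close>

lemma finite_standard_monomials:
  fixes Q :: "'a::{finite, complete_lattice} set"
  assumes "atomic TYPE('a)"
  shows "finite (standard_monomials Q I)"
proof -
  have le: "atom_dist v b \<le> card (UNIV :: 'a set)" if "v \<le> b" for v b :: 'a
    using atom_dist_witness[OF assms that] card_mono[of UNIV] by (metis finite subset_UNIV)
  have "Poly_Mapping.lookup m C \<le> card (UNIV :: 'a set)" if "m \<in> standard_monomials Q I" for m C
  proof (cases "C \<in> Q")
    case True
    then show ?thesis
      using that le[OF Sup_lt_le, of "I \<union> Poly_Mapping.keys m" C]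
        by (force simp: standard_monomials_def)
  next
    case False
    then have "C \<notin> Poly_Mapping.keys m" using that by (auto simp: standard_monomials_def)
    then show ?thesis by (simp add: in_keys_iff)
  qed
  then have "Poly_Mapping.lookup ` standard_monomials Q I \<subseteq> UNIV \<rightarrow>\<^sub>E {..card (UNIV :: 'a set)}"
    by (auto simp: PiE_def)
  then have "finite (Poly_Mapping.lookup ` standard_monomials Q I)"
    by (rule finite_subset) (intro finite_PiE; simp)
  then show ?thesis
    by (rule finite_imageD) (intro inj_onI poly_mapping_eqI, simp)
qed

lemma lookup_sum_of_int_monomial:
  assumes "finite S"
  shows "Poly_Mapping.lookup (\<Sum>m\<in>S. of_int (c m) * monomial m) k = (if k \<in> S then c k else 0)"
  using assms by (simp add: of_int_mult_mono lookup_sum lookup_single when_def)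

lemma lookup_of_int_mult: "Poly_Mapping.lookup (of_int c * p) k = c * Poly_Mapping.lookup p k"
proof -
  have "Poly_Mapping.lookup (of_nat n * p) k = int n * Poly_Mapping.lookup p k" for n
    by (induction n) (auto simp: lookup_add algebra_simps)
  then show ?thesis
    by (cases c rule: int_cases2) auto
qed

text \<open>The classes of the standard monomials are independent, which bounds the rank from below.
  Conversely, independent classes have standard representatives, and more of these than standard
  monomials would be linearly dependent over the integers.\<close>

theorem (in overlap_closed) rank_Z_D_ring:
  "rank_Z (D_ring G I) = card (standard_monomials G I)"
proof -
  let ?S = "standard_monomials G I"
  let ?J = "ideal_span (relations G G I)"
  let ?\<pi> = "residue_class G I"
  have fin: "finite ?S" by (rule finite_standard_monomials[OF atomic])
  have indep: "p = 0" if "Poly_Mapping.keys p \<subseteq> ?S" "p \<in> ?J" for p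
    using standard_independent_spanning[of G p I 0] that by auto
  have polys: "p \<in> polys_in G" if "Poly_Mapping.keys p \<subseteq> ?S" for p
    using that by (auto simp: polys_in_def standard_monomials_def)
  interpret h: ring_hom_ring "zpoly_ring G" "D_ring G I" ?\<pi>
    by (rule residue_class_hom)
  have \<pi>0: "\<zero>\<^bsub>D_ring G I\<^esub> = ?\<pi> 0"
    using h.hom_zero by simp
  \<comment> \<open>By independence a combination of standard polynomials is 0 in the quotient only
    if it is 0 as a polynomial. The index type is that of residue classes because \<open>X\<close>
    is such a set in both applications.\<close>
  have eq0: "(\<Oplus>\<^bsub>D_ring G I\<^esub>x\<in>X. [(c x :: int)] \<cdot>\<^bsub>D_ring G I\<^esub> ?\<pi> (f x)) = \<zero>\<^bsub>D_ring G I\<^esub> \<longleftrightarrow>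
      (\<Sum>x\<in>X. of_int (c x) * f x) = 0"
    if "finite X" "\<And>x. x \<in> X \<Longrightarrow> Poly_Mapping.keys (f x) \<subseteq> ?S" for X :: "'a zpoly set set" and c f
  proof -
    have k: "Poly_Mapping.keys (\<Sum>x\<in>X. of_int (c x) * f x) \<subseteq> ?S"
    proof -
      have "Poly_Mapping.keys (of_int (c x) * f x) \<subseteq> ?S" if "x \<in> X" for x
        using \<open>\<And>x. x \<in> X \<Longrightarrow> Poly_Mapping.keys (f x) \<subseteq> ?S\<close>[OF that]
        by (auto simp: in_keys_iff lookup_of_int_mult)
      then show ?thesis using keys_sum[of "\<lambda>x. of_int (c x) * f x" X] by blast
    qed
    have "(\<Oplus>\<^bsub>D_ring G I\<^esub>x\<in>X. [c x] \<cdot>\<^bsub>D_ring G I\<^esub> ?\<pi> (f x)) = ?\<pi> (\<Sum>x\<in>X. of_int (c x) * f x)"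
      using that polys by (intro residue_class_lincomb) auto
    also have "\<dots> = \<zero>\<^bsub>D_ring G I\<^esub> \<longleftrightarrow> (\<Sum>x\<in>X. of_int (c x) * f x) \<in> ?J"
      unfolding \<pi>0 using polys[OF k] by (simp add: residue_class_eq_iff)
    finally show ?thesis using indep[OF k] by auto
  qed
  have upper: "card X \<le> card ?S" if X: "Z_independent (D_ring G I) X" for X
  proof (rule ccontr)
    assume "\<not> card X \<le> card ?S"
    have finX: "finite X" and sub: "X \<subseteq> carrier (D_ring G I)" using X
      by (auto simp: Z_independent_def)
    have "\<exists>s. Poly_Mapping.keys s \<subseteq> ?S \<and> ?\<pi> s = x" if x: "x \<in> X" for x
    proof -
      obtain q where q: "q \<in> polys_in G" "x = ?\<pi> q" using sub x by (auto simp: carrier_D_ring)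
      then obtain s where "Poly_Mapping.keys s \<subseteq> ?S" "q - s \<in> ?J"
        using standard_independent_spanning[of G 0 I q] by auto
      then show ?thesis using q polys residue_class_eq_iff[of q G s I] by auto
    qed
    then obtain s where s: "\<And>x. x \<in> X \<Longrightarrow> Poly_Mapping.keys (s x) \<subseteq> ?S" "\<And>x. x \<in> X \<Longrightarrow> ?\<pi> (s x) = x"
      by metis
    obtain c where c: "\<exists>x\<in>X. c x \<noteq> 0" "\<forall>m\<in>?S. (\<Sum>x\<in>X. c x * Poly_Mapping.lookup (s x) m) = 0"
      using int_linear_dependence[OF fin finX, of
        "\<lambda>x. Poly_Mapping.lookup (s x)"] \<open>\<not> card X \<le> card ?S\<close>
      by auto
    have "(\<Sum>x\<in>X. of_int (c x) * s x) = 0"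
    proof (rule poly_mapping_eqI)
      fix m
      have "(\<Sum>x\<in>X. c x * Poly_Mapping.lookup (s x) m) = 0"
      proof (cases "m \<in> ?S")
        case False
        then have "Poly_Mapping.lookup (s x) m = 0" if "x \<in> X" for x
          using s(1)[OF that] by (auto simp: in_keys_iff)
        then show ?thesis by simp
      qed (use c(2) in blast)
      then show "Poly_Mapping.lookup (\<Sum>x\<in>X. of_int (c x) * s x) m = Poly_Mapping.lookup 0 m"
        by (simp add: lookup_sum lookup_of_int_mult)
    qed
    then have "(\<Oplus>\<^bsub>D_ring G I\<^esub>x\<in>X. [c x] \<cdot>\<^bsub>D_ring G I\<^esub> ?\<pi> (s x)) = \<zero>\<^bsub>D_ring G I\<^esub>"
      using eq0[OF finX s(1)] by simp
    moreover have "(\<Oplus>\<^bsub>D_ring G I\<^esub>x\<in>X. [c x] \<cdot>\<^bsub>D_ring G I\<^esub> ?\<pi> (s x))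
      = (\<Oplus>\<^bsub>D_ring G I\<^esub>x\<in>X. [c x] \<cdot>\<^bsub>D_ring G I\<^esub> x)"
      by (rule D.finsum_cong') (use s(2) sub in auto)
    ultimately show False using X c(1) unfolding Z_independent_def by auto
  qed
  have lower: "\<exists>X. Z_independent (D_ring G I) X \<and> card X = card ?S"
  proof -
    let ?g = "\<lambda>m. ?\<pi> (monomial m)"
    have mon: "Poly_Mapping.keys (monomial m) \<subseteq> ?S" if "m \<in> ?S" for m
      using that by (simp add: monomial_def)
    have inj: "inj_on ?g ?S"
    proof (rule inj_onI)
      fix m n assume mn: "m \<in> ?S" "n \<in> ?S" "?g m = ?g n"
      then have "monomial m - monomial n \<in> ?J"
        using residue_class_eq_iff[of "monomial m" G "monomial n" I] polys mon by auto
      moreover have "Poly_Mapping.keys (monomial m - monomial n) \<subseteq> ?S"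
        using keys_diff[of "monomial m" "monomial n"] mon mn by blast
      ultimately have "monomial m - monomial n = 0" by (rule indep[rotated])
      then show "m = n" by (simp add: monomial_def frag_of_eq)
    qed
    \<comment> \<open>\<open>Z_independent\<close> takes coefficients indexed by residue classes, so
      each monomial has to be recovered from its class.\<close>
    define h where "h = the_inv_into ?S ?g"
    have h: "h (?g m) = m" if "m \<in> ?S" for m
      unfolding h_def by (rule the_inv_into_f_f[OF inj that])
    let ?X = "?g ` ?S"
    have mh: "Poly_Mapping.keys (monomial (h x)) \<subseteq> ?S" if "x \<in> ?X" for x
      using that mon h by force
    have "Z_independent (D_ring G I) ?X"
      unfolding Z_independent_def
    proof (intro conjI allI impI)
      show "finite ?X" using fin by simp
      show "?X \<subseteq> carrier (D_ring G I)" using polys mon by (auto simp: carrier_D_ring)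
      fix c :: "_ \<Rightarrow> int"
      assume "(\<Oplus>\<^bsub>D_ring G I\<^esub>x\<in>?X. [c x] \<cdot>\<^bsub>D_ring G I\<^esub> x) = \<zero>\<^bsub>D_ring G I\<^esub>"
      moreover have "(\<Oplus>\<^bsub>D_ring G I\<^esub>x\<in>?X. [c x] \<cdot>\<^bsub>D_ring G I\<^esub> x) =
          (\<Oplus>\<^bsub>D_ring G I\<^esub>x\<in>?X. [c x] \<cdot>\<^bsub>D_ring G I\<^esub> ?\<pi> (monomial (h x)))"
        by (rule D.finsum_cong')
          (use polys mon h in \<open>auto simp: carrier_D_ring residue_class_add_pow polys_in_mult polys_in_of_int\<close>)
      ultimately have "(\<Sum>x\<in>?X. of_int (c x) * monomial (h x)) = 0"
        using eq0[where X = ?X and f = "\<lambda>x. monomial (h x)" and c = c, OF _ mh] fin by simp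
      then have "(\<Sum>m\<in>?S. of_int (c (?g m)) * monomial m) = 0"
        by (simp add: sum.reindex[OF inj] h)
      then have "c (?g m) = 0" if "m \<in> ?S" for m
        using lookup_sum_of_int_monomial[OF fin, of "\<lambda>m. c (?g m)" m] that by simp
      then show "\<forall>x\<in>?X. c x = 0" by auto
    qed
    moreover have "card ?X = card ?S" using inj by (rule card_image)
    ultimately show ?thesis by blast
  qed
  show ?thesis
    unfolding rank_Z_def
  proof (rule Max_eqI)
    show "finite {card X |X. Z_independent (D_ring G I) X}"
      by (rule finite_subset[of _ "{..card ?S}"]) (use upper in auto)
  qed (use upper lower in \<open>auto, metis\<close>)
qed

section \<open>Product decompositions given by building sets\<close>

text \<open>A maximal element strictly below \<open>x\<close> is covered by \<open>x\<close> and has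
  fewer elements below it. Together with rankedness this makes the description in \<open>rk\<close>
  well defined.\<close>

lemma exists_covers_chain: "\<exists>r. (bot, x) \<in> covers ^^ r" for x :: "'a::{finite, order_bot}"
proof (induction "card {z. z < x}" arbitrary: x rule: less_induct)
  case less
  show ?case
  proof (cases "x = bot")
    case True
    then show ?thesis by (intro exI[of _ 0]) simp
  next
    case False
    then have "bot \<in> {z. z < x}" by (simp add: bot.not_eq_extremum)
    then obtain y where y: "y < x" "\<forall>z\<in>{z. z < x}. y \<le> z \<longrightarrow> y = z"
      using finite_has_maximal2[of "{z. z < x}" bot] by auto
    have "card {z. z < y} < card {z. z < x}"
      using y(1) by (intro psubset_card_mono) (auto intro: less_trans)
    then obtain r where "(bot, y) \<in> covers ^^ r" using less.hyps by blast
    moreover have "(y, x) \<in> covers" using y by (auto simp: covers_def less_le)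
    ultimately have "(bot, x) \<in> covers ^^ Suc r" by (rule relpow_Suc_I)
    then show ?thesis by blast
  qed
qed

lemma rk_eqI:
  assumes "ranked TYPE('a::{finite, order_bot})" "(bot, x::'a) \<in> covers ^^ r"
  shows "rk x = r"
  unfolding rk_def using assms by (intro the_equality) (auto simp: ranked_def)

lemma rk_chain:
  assumes "ranked TYPE('a::{finite, order_bot})"
  shows "(bot, x::'a) \<in> covers ^^ rk x"
  using exists_covers_chain[of x] rk_eqI[OF assms] by blast

lemma atom_not_bot: "a \<in> lattice_atoms \<Longrightarrow> a \<noteq> bot"
  by (auto simp: lattice_atoms_def covers_def)

text \<open>The isomorphism from the interval below \<open>p\<close> to the product of the intervals
  below the factors, in internal form: meets with the factors and joins of families are mutually
  inverse.\<close>

locale product_decomposition =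
  fixes p :: "'a::{finite, complete_lattice}" and F :: "'a set"
  assumes le: "g \<in> F \<Longrightarrow> g \<le> p"
    and eq_Sup_inf: "y \<le> p \<Longrightarrow> y = Sup ((\<lambda>g. inf y g) ` F)"
    and inf_Sup: "(\<And>g. g \<in> F \<Longrightarrow> z g \<le> g) \<Longrightarrow> h \<in> F \<Longrightarrow> inf (Sup (z ` F)) h = z h"
begin

lemma inf_distinct: "g \<in> F \<Longrightarrow> h \<in> F \<Longrightarrow> g \<noteq> h \<Longrightarrow> inf g h = bot"
proof -
  assume *: "g \<in> F" "h \<in> F" "g \<noteq> h"
  \<comment> \<open>The family of coordinates of \<open>g\<close> itself.\<close>
  let ?z = "\<lambda>k. if k = g then g else bot"
  have "Sup (?z ` F) = g"
    using *(1) by (intro antisym Sup_least Sup_upper) auto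
  then show ?thesis using inf_Sup[of ?z h] * by auto
qed

lemma Sup_factors: "Sup F = p"
proof (rule antisym)
  have "p = Sup ((\<lambda>g. inf p g) ` F)" by (rule eq_Sup_inf) simp
  also have "\<dots> \<le> Sup F" by (rule Sup_mono) (metis imageE inf.cobounded2)
  finally show "p \<le> Sup F" .
qed (auto intro: Sup_least le)

lemma below_unique: "g \<in> F \<Longrightarrow> h \<in> F \<Longrightarrow> x \<le> g \<Longrightarrow> x \<le> h \<Longrightarrow> x \<noteq> bot \<Longrightarrow> g = h"
  using inf_distinct[of g h] by (metis inf_greatest bot.extremum_uniqueI)

text \<open>The atom is the join of its meets with the factors, so one meet is not
  \<open>bot\<close> and must be the atom itself.\<close>

lemma atom_below_factor:
  assumes "a \<in> lattice_atoms" "a \<le> p" shows "\<exists>g\<in>F. a \<le> g"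
proof -
  have a: "bot < a" "\<And>z. bot < z \<Longrightarrow> \<not> z < a" using assms(1)
    by (auto simp: lattice_atoms_def covers_def)
  have "\<exists>g\<in>F. inf a g \<noteq> bot"
  proof (rule ccontr)
    assume "\<not> ?thesis"
    then have "Sup ((\<lambda>g. inf a g) ` F) \<le> bot" by (intro Sup_least) auto
    then show False using eq_Sup_inf[OF assms(2)] a(1) by (metis bot.extremum_uniqueI less_irrefl)
  qed
  then obtain g where g: "g \<in> F" "inf a g \<noteq> bot" by blast
  then have "inf a g = a" using a(2)[of "inf a g"]
    by (metis bot.not_eq_extremum inf.cobounded1 less_le)
  then show ?thesis using g(1) by (metis inf.cobounded2)
qed

lemma num_atoms_eq_sum: "num_atoms p = (\<Sum>g\<in>F. num_atoms g)"
proof -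
  have "{a \<in> lattice_atoms. a \<le> p} = (\<Union>g\<in>F. {a \<in> lattice_atoms. a \<le> g})"
    using atom_below_factor le by (auto intro: order_trans)
  moreover have "\<forall>g\<in>F. \<forall>h\<in>F. g \<noteq> h \<longrightarrow> {a \<in> lattice_atoms. a \<le> g} \<inter> {a \<in> lattice_atoms. a \<le> h} = {}"
    using below_unique atom_not_bot by blast
  ultimately show ?thesis
    unfolding num_atoms_def by (simp only:) (intro card_UN_disjoint, auto)
qed

text \<open>Factors are added one by one. Joining with \<open>y\<close>, the join of the earlier
  factors, shifts a maximal chain below \<open>g\<close> to one from \<open>y\<close> to
  \<open>sup y g\<close>, so the lengths add.\<close>

lemma rk_eq_sum:
  assumes ranked: "ranked TYPE('a)"
  shows "rk p = (\<Sum>g\<in>F. rk g)"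
proof -
  have "rk (Sup F') = (\<Sum>g\<in>F'. rk g)" if "F' \<subseteq> F" for F'
    using finite[of F'] that
  proof (induction F' rule: finite_induct)
    case empty
    have "(bot, bot :: 'a) \<in> covers ^^ 0" by simp
    then show ?case using rk_eqI[OF ranked, of bot 0] by simp
  next
    case (insert g F')
    define y where "y = Sup F'"
    \<comment> \<open>The family \<open>z w\<close> lists the coordinates of
      \<open>sup y w\<close>.\<close>
    define z where "z = (\<lambda>w h. if h = g then w else if h \<in> F' then h else bot)"
    have z: "Sup (z w ` F) = sup y w" "\<And>h. h \<in> F \<Longrightarrow> inf (sup y w) h = z w h" if "w \<le> g" for w
    proof -
      show eq: "Sup (z w ` F) = sup y w"
      proof (rule antisym)
        show "Sup (z w ` F) \<le> sup y w"
          by (rule Sup_least) (auto simp: z_def y_def intro: le_supI1 Sup_upper)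
        show "sup y w \<le> Sup (z w ` F)"
          unfolding y_def using insert.prems insert.hyps
          by (intro sup_least Sup_least Sup_upper) (auto simp: z_def image_iff intro!: bexI)
      qed
      show "inf (sup y w) h = z w h" if "h \<in> F" for h
        using inf_Sup[of "z w" h] \<open>w \<le> g\<close> that unfolding eq by (auto simp: z_def)
    qed
    have chain: "(y, sup y w) \<in> covers ^^ r" if "(bot, w) \<in> covers ^^ r" "w \<le> g" for w r
      using that
    proof (induction r arbitrary: w)
      case 0
      then show ?case by simp
    next
      case (Suc r)
      then obtain v where v: "(bot, v) \<in> covers ^^ r" "(v, w) \<in> covers" by (auto elim: relpow_Suc_E)
      then have vw: "v < w" "\<And>u. v < u \<Longrightarrow> u < w \<Longrightarrow> False" by (auto simp: covers_def)
      have vg: "v \<le> g" using vw(1) Suc.prems(2) by simp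
      have gF: "g \<in> F" using insert.prems by simp
      have eq_z: "u = Sup ((\<lambda>h. inf u h) ` F)" if "u \<le> sup y w" for u
      proof (rule eq_Sup_inf)
        have "sup y w \<le> p" unfolding y_def using insert.prems Suc.prems(2) le
          by (intro sup_least Sup_least) (auto intro: order_trans)
        then show "u \<le> p" by (rule order_trans[OF that])
      qed
      \<comment> \<open>An element in between has the same coordinates as both ends except at
        \<open>g\<close>. There it lies between \<open>v\<close> and \<open>w\<close>, hence equals
        one of them, so it is one of the ends.\<close>
      have "(sup y v, sup y w) \<in> covers"
        unfolding covers_def
      proof (clarify, intro conjI notI)
        have "sup y v \<noteq> sup y w"
        proof
          assume "sup y v = sup y w"
          then have "z v g = z w g" using z(2)[OF vg gF] z(2)[OF Suc.prems(2) gF] by (simp only:)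
          then show False using vw(1) by (simp add: z_def)
        qed
        then show "sup y v < sup y w"
          using sup_mono[OF order_refl less_imp_le[OF vw(1)], of y]
            by (rule order.not_eq_order_implies_strict)
      next
        assume "\<exists>u. sup y v < u \<and> u < sup y w"
        then obtain u where u: "sup y v < u" "u < sup y w" by blast
        have h: "inf u h = z v h" if "h \<in> F" "h \<noteq> g" for h
        proof (rule antisym)
          have "inf u h \<le> inf (sup y w) h" by (rule inf_mono[OF less_imp_le[OF u(2)] order_refl])
          also have "\<dots> = z v h" using z(2)[OF Suc.prems(2) that(1)] that by (simp add: z_def)
          finally show "inf u h \<le> z v h" .
          have "z v h = inf (sup y v) h" using z(2)[OF vg that(1)] by simp
          also have "\<dots> \<le> inf u h" by (rule inf_mono[OF less_imp_le[OF u(1)] order_refl])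
          finally show "z v h \<le> inf u h" .
        qed
        have "v = inf (sup y v) g" using z(2)[OF vg gF] by (simp add: z_def)
        also have "\<dots> \<le> inf u g" by (rule inf_mono[OF less_imp_le[OF u(1)] order_refl])
        finally have 1: "v \<le> inf u g" .
        have "inf u g \<le> inf (sup y w) g" by (rule inf_mono[OF less_imp_le[OF u(2)] order_refl])
        also have "\<dots> = w" using z(2)[OF Suc.prems(2) gF] by (simp add: z_def)
        finally have 2: "inf u g \<le> w" .
        from 1 2 consider "inf u g = v" | "inf u g = w" using vw(2)[of "inf u g"]
          by (auto simp: less_le)
        then show False
        proof cases
          case 1
          then have "inf u k = z v k" if "k \<in> F" for k using h that by (cases "k
            = g") (auto simp: z_def)
          then have "Sup ((\<lambda>k. inf u k) ` F) = Sup (z v ` F)" by (intro arg_cong[where f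
            = Sup] image_cong) auto
          then show False using eq_z[of u] u z(1)[OF vg] by simp
        next
          case 2
          then have "inf u k = z w k" if "k \<in> F" for k using h that by (cases "k
            = g") (auto simp: z_def)
          then have "Sup ((\<lambda>k. inf u k) ` F) = Sup (z w ` F)" by (intro arg_cong[where f
            = Sup] image_cong) auto
          then show False using eq_z[of u] u z(1)[OF Suc.prems(2)] by simp
        qed
      qed
      with Suc.IH[OF v(1) vg] show ?case by (rule relpow_Suc_I)
    qed
    have "(bot, y) \<in> covers ^^ rk y" by (rule rk_chain[OF ranked])
    moreover have "(y, sup y g) \<in> covers ^^ rk g" by (rule chain[OF rk_chain[OF ranked]]) simp
    ultimately have "(bot, sup y g) \<in> covers ^^ (rk y + rk g)"
      by (auto simp: relpow_add)
    then have "rk (sup y g) = rk y + rk g" by (rule rk_eqI[OF ranked])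
    then show ?case using insert by (simp add: y_def sup_commute)
  qed
  from this[of F] show ?thesis by (simp add: Sup_factors)
qed

text \<open>Optimal atom sets for the coordinates combine to one for \<open>p\<close>. Conversely
  each atom below \<open>p\<close> lies below exactly one factor, so an optimal set for
  \<open>p\<close> splits into disjoint sets, each sufficient in its coordinate.\<close>

lemma atom_dist_eq_sum:
  assumes atomic: "atomic TYPE('a)" and V: "v \<le> p"
  shows "atom_dist v p = (\<Sum>g\<in>F. atom_dist (inf v g) g)"
proof (rule antisym)
  have "\<forall>g. \<exists>X \<subseteq> lattice_atoms. card X = atom_dist (inf v g) g \<and> g = sup (inf v g) (Sup X)"
    using atom_dist_witness[OF atomic] by simp
  then obtain X where X: "\<And>g. X g \<subseteq> lattice_atoms" "\<And>g. card (X g) = atom_dist (inf v g) g"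
    "\<And>g. g = sup (inf v g) (Sup (X g))"
    by metis
  have "p = sup v (Sup (\<Union>g\<in>F. X g))"
  proof (rule antisym)
    show "p \<le> sup v (Sup (\<Union>g\<in>F. X g))"
      unfolding Sup_factors[symmetric]
    proof (rule Sup_least)
      fix g assume g: "g \<in> F"
      have "sup (inf v g) (Sup (X g)) \<le> sup v (Sup (\<Union>g\<in>F. X g))"
        using g by (intro sup_mono Sup_subset_mono) auto
      then show "g \<le> sup v (Sup (\<Union>g\<in>F. X g))" using X(3)[of g] by simp
    qed
    show "sup v (Sup (\<Union>g\<in>F. X g)) \<le> p"
    proof (intro sup_least V Sup_least)
      fix a assume "a \<in> (\<Union>g\<in>F. X g)"
      then obtain g where g: "g \<in> F" "a \<in> X g" by blast
      have "a \<le> Sup (X g)" using g(2) by (rule Sup_upper)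
      also have "\<dots> \<le> g" using X(3)[of g] by (metis sup.cobounded2)
      also have "\<dots> \<le> p" using g(1) by (rule le)
      finally show "a \<le> p" .
    qed
  qed
  then have "atom_dist v p \<le> card (\<Union>g\<in>F. X g)"
    using X(1) by (intro atom_dist_le) auto
  also have "\<dots> \<le> (\<Sum>g\<in>F. card (X g))" by (rule card_UN_le) simp
  finally show "atom_dist v p \<le> (\<Sum>g\<in>F. atom_dist (inf v g) g)" using X(2) by simp
next
  obtain X where X: "X \<subseteq> lattice_atoms" "card X = atom_dist v p" "p = sup v (Sup X)"
    using atom_dist_witness[OF atomic V] by blast
  define Y where "Y = (\<lambda>g. {a\<in>X. a \<le> g})"
  define z where "z = (\<lambda>g. sup (inf v g) (Sup (Y g)))"
  have zg: "z g \<le> g" for g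
    unfolding z_def Y_def by (intro sup_least Sup_least) auto
  have "p \<le> Sup (z ` F)"
    unfolding X(3)
  proof (intro sup_least Sup_least)
    have "Sup ((\<lambda>g. inf v g) ` F) \<le> Sup (z ` F)"
      by (rule SUP_mono) (metis z_def sup.cobounded1)
    then show "v \<le> Sup (z ` F)" using eq_Sup_inf[OF V] by simp
  next
    fix a assume a: "a \<in> X"
    then have "a \<le> p" unfolding X(3) by (intro le_supI2 Sup_upper)
    then obtain g where g: "g \<in> F" "a \<le> g" using atom_below_factor a X(1) by blast
    then have "a \<le> z g" unfolding z_def Y_def using a by (intro le_supI2 Sup_upper) auto
    also have "\<dots> \<le> Sup (z ` F)" using g(1) by (intro Sup_upper) auto
    finally show "a \<le> Sup (z ` F)" .
  qed
  then have "z g = g" if "g \<in> F" for g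
    using inf_Sup[of z g] zg that le[OF that] by (metis inf.absorb2 order_trans)
  then have "atom_dist (inf v g) g \<le> card (Y g)" if "g \<in> F" for g
    using that X(1) by (intro atom_dist_le) (auto simp: Y_def z_def)
  then have "(\<Sum>g\<in>F. atom_dist (inf v g) g) \<le> (\<Sum>g\<in>F. card (Y g))" by (rule sum_mono)
  also have "\<dots> = card (\<Union>g\<in>F. Y g)"
  proof (rule card_UN_disjoint[symmetric])
    show "\<forall>g\<in>F. \<forall>h\<in>F. g \<noteq> h \<longrightarrow> Y g \<inter> Y h = {}"
      using below_unique atom_not_bot X(1) unfolding Y_def by blast
  qed auto
  also have "\<dots> \<le> card X" by (rule card_mono) (auto simp: Y_def)
  finally show "(\<Sum>g\<in>F. atom_dist (inf v g) g) \<le> atom_dist v p" using X(2) by simp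
qed

end

text \<open>The coordinates of \<open>\<phi>\<close> need not be meets, since automorphisms of the
  intervals are allowed. Only comparisons of coordinates and the prescribed images of the factors
  are used.\<close>

lemma building_set_product_decomposition:
  fixes G :: "'a::{finite, complete_lattice} set"
  assumes G: "building_set G" and p: "p \<noteq> bot"
  shows "product_decomposition p (factors G p)"
proof -
  let ?F = "factors G p"
  obtain \<phi> where bij: "bij_betw \<phi> {bot..p} (\<Pi>\<^sub>E g\<in>?F. {bot..g})"
    and ord: "\<forall>x\<in>{bot..p}. \<forall>y\<in>{bot..p}. x \<le> y \<longleftrightarrow> (\<forall>g\<in>?F. \<phi> x g \<le> \<phi> y g)"
    and gen: "\<forall>g\<in>?F. \<phi> g = (\<lambda>h\<in>?F. if h = g then g else bot)"
    using G p unfolding building_set_def by blast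
  have le: "g \<le> p" if "g \<in> ?F" for g using that by (simp add: factors_def maximals_def)
  have \<phi>_le: "\<phi> y g \<le> g" if "y \<le> p" "g \<in> ?F" for y g
    using bij_betwE[OF bij] that by (auto simp: PiE_def Pi_def)
  have ord': "x \<le> y \<longleftrightarrow> (\<forall>g\<in>?F. \<phi> x g \<le> \<phi> y g)" if "x \<le> p" "y \<le> p" for x y
    using ord that by simp
  have onto: "\<exists>y. y \<le> p \<and> (\<forall>g\<in>?F. \<phi> y g = t g)" if "\<And>g. g \<in> ?F \<Longrightarrow> t g \<le> g" for t
  proof -
    have "restrict t ?F \<in> (\<Pi>\<^sub>E g\<in>?F. {bot..g})" using that by auto
    then obtain y where "y \<in> {bot..p}" "\<phi> y = restrict t ?F"
      using bij unfolding bij_betw_def by (metis imageE)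
    then show ?thesis by (intro exI[of _ y]) auto
  qed
  have supp: "\<phi> z h = bot" if "z \<le> g" "g \<in> ?F" "h \<in> ?F" "h \<noteq> g" for z g h
  proof -
    have "z \<le> p" using that(1) le[OF that(2)] by simp
    then have "\<phi> z h \<le> \<phi> g h" using ord'[of z g] that le[OF that(2)] by auto
    then show ?thesis using gen that by (auto simp: bot.extremum_unique)
  qed
  show ?thesis
  proof
    show "g \<le> p" if "g \<in> ?F" for g using that by (rule le)
  next
    fix y assume y: "y \<le> p"
    let ?s = "Sup ((\<lambda>g. inf y g) ` ?F)"
    have s: "?s \<le> y" by (rule Sup_least) auto
    have "\<phi> y h \<le> \<phi> ?s h" if h: "h \<in> ?F" for h
    proof -
      \<comment> \<open>The element with coordinate \<open>\<phi> y h\<close> at \<open>h\<close>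
        and \<open>bot\<close> elsewhere lies below both \<open>y\<close> and \<open>h\<close>, so
        \<open>inf y h\<close> accounts for the full coordinate of \<open>y\<close> at
        \<open>h\<close>.\<close>
      let ?t = "\<lambda>g. if g = h then \<phi> y h else bot"
      have "\<exists>z. z \<le> p \<and> (\<forall>g\<in>?F. \<phi> z g = ?t g)"
        by (rule onto) (use \<phi>_le[OF y h] in auto)
      then obtain z where z: "z \<le> p" "\<forall>g\<in>?F. \<phi> z g = ?t g" by blast
      have "z \<le> y" using ord'[OF z(1) y] z(2) by auto
      moreover have "z \<le> h" using ord'[OF z(1) le[OF h]] z(2) gen h \<phi>_le[OF y h] by auto
      ultimately have "z \<le> ?s" using h by (meson Sup_upper image_eqI inf_greatest order_trans)
      then have "\<phi> z h \<le> \<phi> ?s h" using ord'[OF z(1), of ?s] s y h by auto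
      then show ?thesis using z(2) h by simp
    qed
    then have "y \<le> ?s" using ord'[OF y, of ?s] s y by auto
    with s show "y = ?s" by (rule antisym[rotated])
  next
    fix z g assume z: "\<And>g. g \<in> ?F \<Longrightarrow> z g \<le> g" and g: "g \<in> ?F"
    let ?s = "Sup (z ` ?F)"
    have zp: "z h \<le> p" if "h \<in> ?F" for h using z[OF that] le[OF that] by simp
    have sp: "?s \<le> p" using zp by (auto intro: Sup_least)
    \<comment> \<open>\<open>u\<close> is an upper bound of the join and agrees with
      \<open>z g\<close> at coordinate \<open>g\<close>, which limits the meet of the join with
      \<open>g\<close>.\<close>
    have "\<exists>u. u \<le> p \<and> (\<forall>h\<in>?F. \<phi> u h = \<phi> (z h) h)"
      by (rule onto) (rule \<phi>_le[OF zp])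
    then obtain u where u: "u \<le> p" "\<forall>h\<in>?F. \<phi> u h = \<phi> (z h) h" by blast
    have "z h \<le> u" if h: "h \<in> ?F" for h
      unfolding ord'[OF zp[OF h] u(1)]
    proof
      fix k assume k: "k \<in> ?F"
      show "\<phi> (z h) k \<le> \<phi> u k"
        using supp[OF z[OF h] h k] u(2) k by (cases "k = h") auto
    qed
    then have "?s \<le> u" by (auto intro: Sup_least)
    have r: "inf ?s g \<le> p" using sp by (rule le_infI1)
    have "inf ?s g \<le> z g"
      unfolding ord'[OF r zp[OF g]]
    proof
      fix h assume h: "h \<in> ?F"
      show "\<phi> (inf ?s g) h \<le> \<phi> (z g) h"
      proof (cases "h = g")
        case True
        have "inf ?s g \<le> u" using \<open>?s \<le> u\<close> by (rule le_infI1)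
        then show ?thesis using ord'[OF r u(1)] u(2) g True by auto
      next
        case False
        then show ?thesis using supp[OF inf.cobounded2 g h] by simp
      qed
    qed
    moreover have "z g \<le> inf ?s g" using z[OF g] g by (intro inf_greatest Sup_upper) auto
    ultimately show "inf ?s g = z g" by (rule antisym)
  qed
qed

lemma factors_in: "g \<in> factors G p \<Longrightarrow> g \<in> G" "g \<in> factors G p \<Longrightarrow> g \<le> p"
  by (simp_all add: factors_def maximals_def)

lemma below_factor:
  fixes G :: "'a::{finite, complete_lattice} set"
  assumes "e \<in> G" "e \<le> p" shows "\<exists>g\<in>factors G p. e \<le> g"
proof -
  obtain g where "g \<in> {g\<in>G. g \<le> p}" "e \<le> g" "\<forall>z\<in>{g\<in>G. g \<le> p}. g \<le> z \<longrightarrow> g = z"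
    using finite_has_maximal2[of "{g\<in>G. g \<le> p}" e] assms by auto
  then show ?thesis by (intro bexI[of _ g]) (auto simp: factors_def maximals_def)
qed

text \<open>\<open>C\<close> and \<open>D\<close> each lie below a factor of their join. The nonzero
  common lower bound forces the two factors to coincide, and that factor is then the whole
  join.\<close>

lemma building_set_overlap_closed:
  fixes G :: "'a::{finite, complete_lattice} set"
  assumes "atomic TYPE('a)" "building_set G"
  shows "overlap_closed G"
proof
  show "atomic TYPE('a)" by fact
  show "bot \<notin> G" using assms(2) by (simp add: building_set_def)
  fix B C D assume *: "C \<in> G" "D \<in> G" "B \<le> C" "B \<le> D" "B \<noteq> bot"
  let ?p = "sup C D"
  have "?p \<noteq> bot" using *(3,5) by (metis bot.extremum_uniqueI le_supI1)
  then interpret product_decomposition ?p "factors G ?p"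
    by (rule building_set_product_decomposition[OF assms(2)])
  obtain g where g: "g \<in> factors G ?p" "C \<le> g" using below_factor[OF *(1), of ?p] by auto
  obtain h where h: "h \<in> factors G ?p" "D \<le> h" using below_factor[OF *(2), of ?p] by auto
  have "g = h" using below_unique[OF g(1) h(1), of B] * g h by auto
  then have "?p \<le> g" using g h by simp
  then have "?p = g" using le[OF g(1)] by (rule antisym)
  then show "?p \<in> G" using g(1) by (simp add: factors_def maximals_def)
qed

section \<open>The zeta function as a sum over nested sets\<close>

definition weight :: "'a::{finite, order_bot} \<Rightarrow> rat poly fract" where
  "weight A = Fract [:of_nat (rk A), of_nat (num_atoms A):] 1"

text \<open>Exponents on the support are positive, which leaves \<open>n a - 1\<close> choices;
  truncated subtraction is also right for \<open>n a = 0\<close>.\<close>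

lemma card_monomials_with_support:
  fixes n :: "'a::finite \<Rightarrow> nat"
  shows "card {m :: 'a \<Rightarrow>\<^sub>0 nat. Poly_Mapping.keys m = S \<and> (\<forall>a\<in>S. Poly_Mapping.lookup m a < n a)}
    = (\<Prod>a\<in>S. n a - 1)"
proof -
  let ?M = "{m :: 'a \<Rightarrow>\<^sub>0 nat. Poly_Mapping.keys m = S \<and> (\<forall>a\<in>S. Poly_Mapping.lookup m a < n a)}"
  have "bij_betw (\<lambda>m. restrict (Poly_Mapping.lookup m) S) ?M (\<Pi>\<^sub>E a\<in>S. {1..<n a})"
  proof (rule bij_betw_imageI)
    show "inj_on (\<lambda>m. restrict (Poly_Mapping.lookup m) S) ?M"
    proof (rule inj_onI, rule poly_mapping_eqI)
      fix m m' a assume *: "m \<in> ?M" "m' \<in> ?M"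
        "restrict (Poly_Mapping.lookup m) S = restrict (Poly_Mapping.lookup m') S"
      show "Poly_Mapping.lookup m a = Poly_Mapping.lookup m' a"
      proof (cases "a \<in> S")
        case True
        then show ?thesis using fun_cong[OF *(3), of a] by simp
      next
        case False
        then have "a \<notin> Poly_Mapping.keys m" "a \<notin> Poly_Mapping.keys m'" using *(1,2) by auto
        then show ?thesis by (simp add: in_keys_iff)
      qed
    qed
    show "(\<lambda>m. restrict (Poly_Mapping.lookup m) S) ` ?M = (\<Pi>\<^sub>E a\<in>S. {1..<n a})"
    proof (intro equalityI subsetI)
      fix f assume "f \<in> (\<lambda>m. restrict (Poly_Mapping.lookup m) S) ` ?M"
      then obtain m where m: "f = restrict (Poly_Mapping.lookup m) S" "Poly_Mapping.keys m = S"
        "\<forall>a\<in>S. Poly_Mapping.lookup m a < n a" by blast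
      have "0 < Poly_Mapping.lookup m a" if "a \<in> S" for a
        using that m(2) by (metis in_keys_iff neq0_conv)
      then show "f \<in> (\<Pi>\<^sub>E a\<in>S. {1..<n a})"
        using m(1,3) by (simp add: PiE_iff Suc_le_eq)
    next
      fix f assume f: "f \<in> (\<Pi>\<^sub>E a\<in>S. {1..<n a})"
      define m where "m = Abs_poly_mapping (\<lambda>a. if a \<in> S then f a else 0)"
      have m: "Poly_Mapping.lookup m a = (if a \<in> S then f a else 0)" for a
        by (simp add: m_def)
      have b: "1 \<le> f a \<and> f a < n a" if "a \<in> S" for a
        using f that by (auto simp: PiE_iff)
      have "a \<in> Poly_Mapping.keys m \<longleftrightarrow> a \<in> S" for a
        using b[of a] by (auto simp: in_keys_iff m)
      then have "m \<in> ?M" using b by (auto simp: m)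
      moreover have "f = restrict (Poly_Mapping.lookup m) S"
        using f by (intro ext) (auto simp: m PiE_iff extensional_def restrict_def)
      ultimately show "f \<in> (\<lambda>m. restrict (Poly_Mapping.lookup m) S) ` ?M" by blast
    qed
  qed
  then have "card ?M = card (\<Pi>\<^sub>E a\<in>S. {1..<n a})" by (rule bij_betw_same_card)
  then show ?thesis by (simp add: card_PiE)
qed

abbreviation gap :: "'a::{finite, complete_lattice} set \<Rightarrow> 'a \<Rightarrow> nat" where
  "gap W A \<equiv> atom_dist (Sup {y\<in>W. y < A}) A"

context overlap_closed
begin

text \<open>Standard monomials are sorted by their support \<open>S\<close>. Outside
  \<open>S\<close> the bounds only say that gaps are positive, which together with the bounds on
  \<open>S\<close> makes \<open>I \<union> S\<close> nested.\<close>

lemma card_standard_monomials: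
  assumes "I \<subseteq> G"
  shows "card (standard_monomials G I) =
    (\<Sum>S\<in>{S. S \<subseteq> G \<and> I \<union> S \<in> nested_sets G}. \<Prod>A\<in>S. gap (I \<union> S) A - 1)"
proof -
  let ?P = "{S. S \<subseteq> G \<and> I \<union> S \<in> nested_sets G}"
  let ?M = "\<lambda>S. {m. Poly_Mapping.keys m = S \<and> (\<forall>A\<in>S. Poly_Mapping.lookup m A < gap (I \<union> S) A)}"
  have nested: "I \<union> S \<in> nested_sets G \<longleftrightarrow> (\<forall>C\<in>G. 0 < gap (I \<union> S) C)" if "S \<subseteq> G" for S
    using nested_sets_iff_atom_dist[OF atomic bot_notin, of "I \<union> S"] assms that by auto
  have "standard_monomials G I = (\<Union>S\<in>?P. ?M S)"
  proof (intro equalityI subsetI)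
    fix m assume m: "m \<in> standard_monomials G I"
    then have "Poly_Mapping.keys m \<subseteq> G" "\<forall>C\<in>G. Poly_Mapping.lookup m C < gap (I \<union> Poly_Mapping.keys m) C"
      by (auto simp: standard_monomials_def)
    then have "Poly_Mapping.keys m \<in> ?P" "m \<in> ?M (Poly_Mapping.keys m)"
      using nested[of "Poly_Mapping.keys m"] by (auto intro: le_less_trans[OF le0])
    then show "m \<in> (\<Union>S\<in>?P. ?M S)" by blast
  next
    fix m assume "m \<in> (\<Union>S\<in>?P. ?M S)"
    then have m: "Poly_Mapping.keys m \<subseteq> G" "I \<union> Poly_Mapping.keys m \<in> nested_sets G"
      "\<forall>A\<in>Poly_Mapping.keys m. Poly_Mapping.lookup m A < gap (I \<union> Poly_Mapping.keys m) A"
      by auto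
    have "Poly_Mapping.lookup m C < gap (I \<union> Poly_Mapping.keys m) C" if "C \<in> G" for C
      using m(3) nested[OF m(1)] m(2) that by (cases
        "C \<in> Poly_Mapping.keys m") (auto simp: in_keys_iff)
    then show "m \<in> standard_monomials G I" using m(1) by (simp add: standard_monomials_def)
  qed
  moreover have "card (\<Union>S\<in>?P. ?M S) = (\<Sum>S\<in>?P. card (?M S))"
  proof (rule card_UN_disjoint)
    show "\<forall>S\<in>?P. finite (?M S)"
      using calculation finite_standard_monomials[OF atomic, of G I] by (auto intro: finite_subset)
  qed auto
  ultimately show ?thesis by (simp add: card_monomials_with_support)
qed

lemma gap_pos: "W \<in> nested_sets G \<Longrightarrow> A \<in> G \<Longrightarrow> 0 < gap W A"
  by (simp add: nested_sets_iff_atom_dist[OF atomic bot_notin])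

text \<open>The supports \<open>T\<close> are grouped by \<open>W = S \<union> T\<close>. Each such
  \<open>T\<close> is \<open>W - S\<close> together with an arbitrary subset of \<open>S\<close>,
  and summing over these subsets raises the factors at members of \<open>S\<close> by 1.\<close>

lemma rank_Z_D_ring_eq:
  assumes S: "S \<in> nested_sets G"
  shows "int (rank_Z (D_ring G S)) = (\<Sum>W\<in>{W \<in> nested_sets G. S \<subseteq> W}.
    (\<Prod>A\<in>W - S. int (gap W A) - 1) * (\<Prod>A\<in>S. int (gap W A)))"
proof -
  let ?P = "{T. T \<subseteq> G \<and> S \<union> T \<in> nested_sets G}"
  let ?N = "{W \<in> nested_sets G. S \<subseteq> W}"
  have SG: "S \<subseteq> G" using S by (simp add: nested_sets_def)
  have "int (rank_Z (D_ring G S)) = (\<Sum>T\<in>?P. \<Prod>A\<in>T. int (gap (S \<union> T) A - 1))"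
    by (simp add: rank_Z_D_ring card_standard_monomials[OF SG])
  also have "\<dots> = (\<Sum>T\<in>?P. \<Prod>A\<in>T. int (gap (S \<union> T) A) - 1)"
  proof (intro sum.cong prod.cong refl)
    fix T A assume "T \<in> ?P" "A \<in> T"
    then have "0 < gap (S \<union> T) A" by (intro gap_pos) auto
    then show "int (gap (S \<union> T) A - 1) = int (gap (S \<union> T) A) - 1"
      by (simp add: of_nat_diff Suc_le_eq)
  qed
  also have "\<dots> = (\<Sum>W\<in>?N. \<Sum>T\<in>{T\<in>?P. S \<union> T = W}. \<Prod>A\<in>T. int (gap (S \<union> T) A) - 1)"
    by (rule sum.group[symmetric]) auto
  also have "\<dots> = (\<Sum>W\<in>?N. (\<Prod>A\<in>W - S. int (gap W A) - 1) * (\<Prod>A\<in>S. int (gap W A)))"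
  proof (rule sum.cong[OF refl])
    fix W assume W: "W \<in> ?N"
    have WG: "W \<subseteq> G" using W by (simp add: nested_sets_def)
    let ?e = "\<lambda>A. int (gap W A) - 1"
    have join: "S \<union> (W - S \<union> X) = W" if "X \<subseteq> S" for X
      using W that by auto
    have "(\<Sum>T\<in>{T\<in>?P. S \<union> T = W}. \<Prod>A\<in>T. int (gap (S \<union> T) A) - 1)
        = (\<Sum>T\<in>{T\<in>?P. S \<union> T = W}. \<Prod>A\<in>T. ?e A)"
      by (intro sum.cong prod.cong refl) auto
    also have "\<dots> = (\<Sum>X\<in>Pow S. \<Prod>A\<in>(W - S) \<union> X. ?e A)"
      by (rule sum.reindex_bij_witness[of _ "\<lambda>X. (W - S) \<union> X" "\<lambda>T. T \<inter> S"])
        (use W WG SG in \<open>auto intro!: prod.cong simp: join\<close>)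
    also have "\<dots> = (\<Sum>X\<in>Pow S. (\<Prod>A\<in>W - S. ?e A) * (\<Prod>A\<in>X. ?e A))"
      by (intro sum.cong refl prod.union_disjoint) auto
    also have "\<dots> = (\<Prod>A\<in>W - S. ?e A) * (\<Sum>X\<in>Pow S. \<Prod>A\<in>X. ?e A)"
      by (simp add: sum_distrib_left)
    also have "(\<Sum>X\<in>Pow S. \<Prod>A\<in>X. ?e A) = (\<Prod>A\<in>S. int (gap W A))"
      using prod_add[of S ?e "\<lambda>_. 1"] by simp
    finally show "(\<Sum>T\<in>{T\<in>?P. S \<union> T = W}. \<Prod>A\<in>T. int (gap (S \<union> T) A) - 1)
        = (\<Prod>A\<in>W - S. ?e A) * (\<Prod>A\<in>S. int (gap W A))" .
  qed
  finally show ?thesis .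
qed

text \<open>The sum over chains of nested sets \<open>U\<close>, \<open>S\<close>, \<open>W\<close>
  is taken with \<open>W\<close> outermost. A member of \<open>W\<close> contributes
  \<open>d v\<close> in \<open>U\<close>, \<open>- d\<close> in \<open>S - U\<close> or
  \<open>d - 1\<close> in \<open>W - S\<close>, with \<open>d\<close> its gap and \<open>v\<close>
  its inverse weight; these choices add up to \<open>d v - 1\<close>.\<close>

lemma zeta_eq:
  "zeta G = (\<Sum>W\<in>nested_sets G. \<Prod>A\<in>W. of_nat (gap W A) * (1 / weight A) - 1)"
proof -
  let ?N = "nested_sets G"
  let ?d = "\<lambda>W A. of_nat (gap W A) :: rat poly fract"
  let ?v = "\<lambda>A. 1 / weight A"
  let ?t = "\<lambda>W S U. (\<Prod>A\<in>W - S. ?d W A - 1) * ((\<Prod>A\<in>U. ?d W A * ?v A) * (\<Prod>A\<in>S - U. - ?d W A))"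
  have rank: "of_int (int (rank_Z (D_ring G S))) = (\<Sum>W\<in>{W\<in>?N. S \<subseteq> W}.
      (\<Prod>A\<in>W - S. ?d W A - 1) * (\<Prod>A\<in>S. ?d W A))" if "S \<in> ?N" for S
    unfolding rank_Z_D_ring_eq[OF that] by simp
  have "zeta G = (\<Sum>U\<in>?N. \<Sum>S\<in>{S\<in>?N. U \<subseteq> S}. \<Sum>W\<in>{W\<in>?N. S \<subseteq> W}. ?t W S U)"
    unfolding zeta_def chi_def weight_def[symmetric] of_int_sum sum_distrib_right
  proof (intro sum.cong refl)
    fix U S assume U: "U \<in> ?N" and S: "S \<in> {S\<in>?N. U \<subseteq> S}"
    have eq: "(- 1) ^ (card S - card U) * ((\<Prod>A\<in>W - S. ?d W A - 1) * (\<Prod>A\<in>S. ?d W A)) * (\<Prod>A\<in>U. ?v A)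
        = ?t W S U" for W
    proof -
      have "(\<Prod>A\<in>S. ?d W A) = (\<Prod>A\<in>S - U. ?d W A) * (\<Prod>A\<in>U. ?d W A)"
        using S by (intro prod.subset_diff) auto
      moreover have "(\<Prod>A\<in>S - U. - ?d W A) = (- 1) ^ (card S - card U) * (\<Prod>A\<in>S - U. ?d W A)"
        using S by (simp add: prod_uminus card_Diff_subset)
      ultimately show ?thesis by (simp only: prod.distrib ac_simps)
    qed
    have "of_int ((- 1) ^ (card S - card U) * int (rank_Z (D_ring G S))) * (\<Prod>A\<in>U. ?v A)
        = (- 1) ^ (card S - card U) * of_int (int (rank_Z (D_ring G S))) * (\<Prod>A\<in>U. ?v A)"
      by simp
    also have "\<dots> = (\<Sum>W\<in>{W\<in>?N. S \<subseteq> W}.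
        (- 1) ^ (card S - card U) * ((\<Prod>A\<in>W - S. ?d W A - 1) * (\<Prod>A\<in>S. ?d W A)) * (\<Prod>A\<in>U. ?v A))"
      using S by (simp only: rank sum_distrib_left sum_distrib_right mem_Collect_eq)
    finally show "of_int ((- 1) ^ (card S - card U) * int (rank_Z (D_ring G S))) * (\<Prod>A\<in>U. ?v A)
        = (\<Sum>W\<in>{W\<in>?N. S \<subseteq> W}. ?t W S U)"
      by (simp only: eq)
  qed
  also have "\<dots> = (\<Sum>S\<in>?N. \<Sum>U\<in>{U\<in>?N. U \<subseteq> S}. \<Sum>W\<in>{W\<in>?N. S \<subseteq> W}. ?t W S U)"
    by (rule sum.swap_restrict) auto
  also have "\<dots> = (\<Sum>S\<in>?N. \<Sum>W\<in>{W\<in>?N. S \<subseteq> W}. \<Sum>U\<in>{U\<in>?N. U \<subseteq> S}. ?t W S U)"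
    by (intro sum.cong refl sum.swap)
  also have "\<dots> = (\<Sum>W\<in>?N. \<Sum>S\<in>{S\<in>?N. S \<subseteq> W}. \<Sum>U\<in>{U\<in>?N. U \<subseteq> S}. ?t W S U)"
    by (rule sum.swap_restrict) auto
  also have "\<dots> = (\<Sum>W\<in>?N. \<Prod>A\<in>W. ?d W A * ?v A - 1)"
  proof (rule sum.cong[OF refl])
    fix W assume W: "W \<in> ?N"
    \<comment> \<open>Subsets of nested sets are nested, so the inner sums run over full power sets
      and factorise.\<close>
    have sub: "{S\<in>?N. S \<subseteq> T} = Pow T" if "T \<subseteq> W" for T
      using nested_sets_subset[OF W] that by blast
    have "(\<Sum>S\<in>{S\<in>?N. S \<subseteq> W}. \<Sum>U\<in>{U\<in>?N. U \<subseteq> S}. ?t W S U)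
        = (\<Sum>S\<in>Pow W. \<Sum>U\<in>Pow S. ?t W S U)"
      unfolding sub[OF order_refl] by (intro sum.cong refl) (simp add: sub)
    also have "\<dots> = (\<Sum>S\<in>Pow W. (\<Prod>A\<in>S. ?d W A * ?v A + - ?d W A) * (\<Prod>A\<in>W - S. ?d W A - 1))"
      by (intro sum.cong refl) (simp only: prod_add[OF finite] sum_distrib_left mult.commute)
    also have "\<dots> = (\<Prod>A\<in>W. (?d W A * ?v A + - ?d W A) + (?d W A - 1))"
      by (rule prod_add[symmetric]) simp
    finally show "(\<Sum>S\<in>{S\<in>?N. S \<subseteq> W}. \<Sum>U\<in>{U\<in>?N. U \<subseteq> S}. ?t W S U)
        = (\<Prod>A\<in>W. ?d W A * ?v A - 1)"
      by simp
  qed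
  finally show ?thesis .
qed

end

section \<open>Independence of the building set\<close>

definition nested_weight :: "'a::{finite, complete_lattice} set \<Rightarrow> rat poly fract" where
  "nested_weight W = (\<Prod>A\<in>W. of_nat (gap W A) * (1 / weight A) - 1)"

text \<open>A new element above all of \<open>W\<close> does not change the gaps at members of
  \<open>W\<close>.\<close>

lemma nested_weight_insert:
  assumes "W \<subseteq> {..<x}"
  shows "nested_weight (insert x W) = nested_weight W * (of_nat (atom_dist (Sup W) x) * (1 / weight x) - 1)"
proof -
  have "{y \<in> insert x W. y < x} = W" using assms by auto
  moreover have "{y \<in> insert x W. y < A} = {y\<in>W. y < A}" if "A \<in> W" for A
    using that assms by (auto dest: less_asym)
  moreover have "x \<notin> W" using assms by auto
  ultimately show ?thesis by (simp add: nested_weight_def mult.commute)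
qed

section \<open>Weights\<close>

lemma weight_bot [simp]: "ranked TYPE('a::{finite, order_bot}) \<Longrightarrow> weight (bot :: 'a) = 0"
proof -
  assume "ranked TYPE('a)"
  then have "rk (bot :: 'a) = 0" by (rule rk_eqI) simp
  moreover have "{a \<in> lattice_atoms. a \<le> (bot :: 'a)} = {}"
    by (auto simp: lattice_atoms_def covers_def bot.extremum_unique)
  then have "num_atoms (bot :: 'a) = 0" by (simp only: num_atoms_def card.empty)
  ultimately show ?thesis by (simp add: weight_def Zero_fract_def)
qed

text \<open>An element other than \<open>bot\<close> has an atom below it, so the coefficient of the
  indeterminate is nonzero.\<close>

lemma weight_not_0:
  fixes x :: "'a::{finite, complete_lattice}"
  assumes "atomic TYPE('a)" "x \<noteq> bot" shows "weight x \<noteq> 0"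
proof -
  obtain T where T: "T \<subseteq> lattice_atoms" "x = Sup T" using assms(1) unfolding atomic_def by blast
  then have "T \<noteq> {}" using assms(2) by auto
  then obtain a where "a \<in> T" by blast
  then have "a \<in> {a \<in> lattice_atoms. a \<le> x}" using T by (auto intro: Sup_upper)
  then have "num_atoms x \<noteq> 0" unfolding num_atoms_def by (metis card_0_eq empty_iff finite)
  then show ?thesis by (simp add: weight_def Zero_fract_def eq_fract)
qed

lemma Fract_sum:
  fixes f :: "'a \<Rightarrow> 'b::idom"
  shows "Fract (sum f A) 1 = (\<Sum>a\<in>A. Fract (f a) 1)"
proof -
  have "Fract (x + y) 1 = Fract x 1 + Fract y 1" for x y :: 'b by simp
  then show ?thesis
    by (induction A rule: infinite_finite_induct) (simp_all add: Zero_fract_def del: add_fract)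
qed

lemma (in product_decomposition) weight_eq_sum:
  assumes "ranked TYPE('a)" shows "weight p = (\<Sum>g\<in>F. weight g)"
proof -
  have "[:of_nat (rk p), of_nat (num_atoms p):]
    = (\<Sum>g\<in>F. [:of_nat (rk g), of_nat (num_atoms g):] :: rat poly)"
  proof -
    have "(\<Sum>g\<in>A. [:f g, h g:]) = [:sum f A, sum h A:]" if "finite A" for A and f h :: "'a \<Rightarrow> rat"
      using that by (induction A) auto
    then show ?thesis by (simp add: rk_eq_sum[OF assms] num_atoms_eq_sum)
  qed
  then show ?thesis by (simp add: weight_def Fract_sum)
qed

locale building =
  fixes G :: "'a::{finite, complete_lattice} set"
  assumes ranked: "ranked TYPE('a)" and atomic: "atomic TYPE('a)" and building: "building_set G"
begin

sublocale overlap_closed G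
  by (rule building_set_overlap_closed[OF atomic building])

lemma nested_iff: "W \<in> nested_sets G \<longleftrightarrow> W \<subseteq> G \<and> (\<forall>C\<in>G. Sup {y\<in>W. y < C} \<noteq> C)"
  by (rule nested_sets_iff[OF bot_notin])

text \<open>Where \<open>x\<close> enters the join of the elements below \<open>C\<close>, that join
  is at most \<open>x\<close>, hence strictly smaller than \<open>C\<close>.\<close>

lemma insert_top_nested:
  assumes "x \<in> G" "W \<subseteq> {..<x}"
  shows "insert x W \<in> nested_sets G \<longleftrightarrow> W \<in> nested_sets G"
proof
  show "insert x W \<in> nested_sets G \<Longrightarrow> W \<in> nested_sets G"
    by (rule nested_sets_subset) auto
  assume W: "W \<in> nested_sets G"
  have "Sup {y \<in> insert x W. y < C} \<noteq> C" if "C \<in> G" for C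
  proof (cases "x < C")
    case True
    then have "Sup {y \<in> insert x W. y < C} \<le> x"
      using assms(2) by (intro Sup_least) auto
    then show ?thesis using True by auto
  next
    case False
    then have "{y \<in> insert x W. y < C} = {y\<in>W. y < C}" by auto
    then show ?thesis using W that nested_iff by auto
  qed
  then show "insert x W \<in> nested_sets G" using W assms(1) nested_iff by auto
qed

text \<open>The terms of \<open>W\<close> and \<open>insert x W\<close> cancel.\<close>

lemma sum_nested_below_member:
  assumes x: "x \<in> G"
  shows "(\<Sum>W\<in>{W\<in>nested_sets G. W \<subseteq> {..x}}. nested_weight W * (weight x - of_nat (atom_dist (Sup W) x))) = 0"
proof -
  let ?L = "{W\<in>nested_sets G. W \<subseteq> {..<x}}"
  let ?f = "\<lambda>W. nested_weight W * (weight x - of_nat (atom_dist (Sup W) x))"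
  have "{W\<in>nested_sets G. W \<subseteq> {..x}} = ?L \<union> insert x ` ?L"
  proof (intro equalityI subsetI)
    fix W assume W: "W \<in> {W\<in>nested_sets G. W \<subseteq> {..x}}"
    show "W \<in> ?L \<union> insert x ` ?L"
    proof (cases "x \<in> W")
      case True
      then have "W = insert x (W - {x})" by auto
      moreover have "W - {x} \<in> ?L" using W nested_sets_subset[of W G "W - {x}"]
        by (auto simp: less_le)
      ultimately show ?thesis by blast
    next
      case False
      then show ?thesis using W by (auto simp: less_le)
    qed
  next
    fix W assume "W \<in> ?L \<union> insert x ` ?L"
    then show "W \<in> {W\<in>nested_sets G. W \<subseteq> {..x}}"
      using insert_top_nested[OF x] by (auto simp: less_imp_le)
  qed
  moreover have "?L \<inter> insert x ` ?L = {}" by auto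
  ultimately have "(\<Sum>W\<in>{W\<in>nested_sets G. W \<subseteq> {..x}}. ?f W)
    = (\<Sum>W\<in>?L. ?f W) + (\<Sum>W\<in>insert x ` ?L. ?f W)"
    by (simp add: sum.union_disjoint)
  also have "(\<Sum>W\<in>insert x ` ?L. ?f W) = (\<Sum>W\<in>?L. ?f (insert x W))"
  proof (rule sum.reindex_cong[of "insert x"])
    show "inj_on (insert x) ?L"
      by (rule inj_onI) (metis (no_types, lifting) insert_ident lessThan_iff less_irrefl mem_Collect_eq subset_iff)
  qed auto
  also have "\<dots> = (\<Sum>W\<in>?L. - ?f W)"
  proof (rule sum.cong[OF refl])
    fix W assume W: "W \<in> ?L"
    \<comment> \<open>With \<open>x\<close> inserted the distance to \<open>x\<close> is 0, and the
      remaining factor \<open>weight x\<close> clears the denominator of the new factor of the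
      product.\<close>
    then have "Sup (insert x W) = x"
      by (intro antisym Sup_least Sup_upper) (auto simp: less_imp_le)
    then have "?f (insert x W) = nested_weight (insert x W) * weight x" by simp
    also have "\<dots> = nested_weight W * (of_nat (atom_dist (Sup W) x) - weight x)"
    proof -
      have "x \<noteq> bot" using x bot_notin by auto
      then have "weight x \<noteq> 0" by (rule weight_not_0[OF atomic])
      then show ?thesis using W by (simp add: nested_weight_insert left_diff_distrib mult.assoc)
    qed
    finally show "?f (insert x W) = - ?f W" by (simp add: algebra_simps)
  qed
  finally show ?thesis by (simp add: sum_negf)
qed

text \<open>A violation of nestedness at \<open>C\<close> takes place below \<open>C\<close>, hence
  below a single factor of \<open>p\<close>.\<close>

lemma nested_if_parts_nested:
  assumes "W \<subseteq> G" "W \<subseteq> {..p}" "\<And>g. g \<in> factors G p \<Longrightarrow> W \<inter> {..g} \<in> nested_sets G"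
  shows "W \<in> nested_sets G"
  unfolding nested_iff
proof (intro conjI ballI notI assms(1))
  fix C assume C: "C \<in> G" "Sup {y\<in>W. y < C} = C"
  have "Sup {y\<in>W. y < C} \<le> p" using assms(2) by (intro Sup_least) auto
  then obtain g where g: "g \<in> factors G p" "C \<le> g" using below_factor[OF C(1)] C(2) by metis
  have "{y\<in>W. y < C} = {y \<in> W \<inter> {..g}. y < C}" using g(2) by auto
  then show False using C assms(3)[OF g(1)] nested_iff by metis
qed

text \<open>Stated for subsets of the factors to allow induction. A nested set below
  \<open>insert g F\<close> splits uniquely into one below \<open>F\<close> and one below
  \<open>g\<close>; nested weights multiply and brackets add, so each of the two resulting products
  has a vanishing factor.\<close>

lemma sum_nested_below_factors:
  assumes p: "p \<noteq> bot" and F: "F \<subseteq> factors G p"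
  shows "(\<Sum>W\<in>{W\<in>nested_sets G. W \<subseteq> (\<Union>g\<in>F. {..g})}.
    nested_weight W * (\<Sum>g\<in>F. weight g - of_nat (atom_dist (Sup (W \<inter> {..g})) g))) = 0"
  using finite[of F] F
proof (induction F rule: finite_induct)
  case empty
  show ?case by simp
next
  case (insert g F)
  interpret product_decomposition p "factors G p"
    by (rule building_set_product_decomposition[OF building p])
  let ?U = "\<Union>h\<in>F. {..h}"
  let ?A = "{W\<in>nested_sets G. W \<subseteq> ?U}"
  let ?B = "{W\<in>nested_sets G. W \<subseteq> {..g}}"
  let ?a = "\<lambda>W h. weight h - of_nat (atom_dist (Sup (W \<inter> {..h})) h) :: rat poly fract"
  let ?f = "\<lambda>W. nested_weight W * (\<Sum>h\<in>insert g F. ?a W h)"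
  have gF: "g \<in> factors G p" "F \<subseteq> factors G p" using insert.prems by auto
  have gG: "g \<in> G" by (rule factors_in(1)[OF gF(1)])
  have sub: "W \<subseteq> G" if "W \<in> nested_sets G" for W using that by (simp add: nested_sets_def)
  have unique: "h = k" if "y \<in> G" "y \<le> h" "y \<le> k" "h \<in> factors G p" "k \<in> factors G p" for y h k
    using below_unique[of h k y] that bot_notin by auto
  have V_g: "V \<inter> {..g} = {}" if "V \<in> ?A" for V
  proof -
    have False if y: "y \<in> V" "y \<le> g" for y
    proof -
      have "y \<in> G" using y(1) \<open>V \<in> ?A\<close> sub by blast
      obtain h where h: "h \<in> F" "y \<le> h" using y(1) \<open>V \<in> ?A\<close> by blast
      then have "h = g" using unique[OF \<open>y \<in> G\<close> h(2) y(2)] gF by blast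
      then show False using h(1) insert.hyps(2) by simp
    qed
    then show ?thesis by blast
  qed
  have W_h: "W \<inter> {..h} = {}" if "W \<in> ?B" "h \<in> factors G p" "h \<noteq> g" for W h
  proof -
    have False if y: "y \<in> W" "y \<le> h" for y
    proof -
      have "y \<in> G" "y \<le> g" using y(1) \<open>W \<in> ?B\<close> sub by blast+
      then have "h = g" using unique[of y h g] y(2) gF(1) \<open>h \<in> factors G p\<close> by blast
      then show False using \<open>h \<noteq> g\<close> by simp
    qed
    then show ?thesis by blast
  qed
  have W_U: "W \<inter> ?U = {}" if "W \<in> ?B" for W
    using W_h[OF that] gF(2) insert.hyps(2) by blast
  have VW_h: "(V \<union> W) \<inter> {..h} = V \<inter> {..h}" if "V \<in> ?A" "W \<in> ?B" "h \<in> factors G p" "h \<noteq> g" for V W h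
    using W_h[OF that(2-4)] by blast
  have VW_g: "(V \<union> W) \<inter> {..g} = W" if "V \<in> ?A" "W \<in> ?B" for V W
    using V_g[OF that(1)] that(2) by blast
  have VW_nested: "V \<union> W \<in> nested_sets G" if VW: "V \<in> ?A" "W \<in> ?B" for V W
  proof (rule nested_if_parts_nested)
    show "V \<union> W \<subseteq> G" using VW sub by auto
    have hp: "{..h} \<subseteq> {..p}" if "h \<in> factors G p" for h using factors_in(2)[OF that] by auto
    have "?U \<subseteq> {..p}"
      by (rule UN_least, rule hp, rule subsetD[OF gF(2)])
    moreover have "V \<subseteq> ?U" "W \<subseteq> {..g}" using VW by simp_all
    ultimately show "V \<union> W \<subseteq> {..p}"
      using order_trans[of V ?U] order_trans[of W "{..g}", OF _ hp[OF gF(1)]] by simp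
    show "(V \<union> W) \<inter> {..h} \<in> nested_sets G" if "h \<in> factors G p" for h
    proof (cases "h = g")
      case True
      then show ?thesis using VW_g[OF VW] VW by simp
    next
      case False
      then show ?thesis
        using VW_h[OF VW that] VW(1) nested_sets_subset[of V G "V \<inter> {..h}"] by simp
    qed
  qed
  have weight_Un: "nested_weight (V \<union> W) = nested_weight V * nested_weight W" if VW: "V \<in> ?A"
    "W \<in> ?B" for V W
  proof -
    have V: "{y \<in> V \<union> W. y < A} = {y\<in>V. y < A}" if A: "A \<in> V" for A
    proof -
      have "A \<in> ?U" using A VW(1) by (simp add: subset_iff)
      then obtain h where h: "h \<in> F" "A \<le> h" by auto
      then have "h \<in> factors G p" "h \<noteq> g" using gF(2) insert.hyps(2) by auto
      then have "W \<inter> {..h} = {}" by (rule W_h[OF VW(2)])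
      then show ?thesis using h(2) by auto
    qed
    have W: "{y \<in> V \<union> W. y < A} = {y\<in>W. y < A}" if "A \<in> W" for A
    proof -
      have "A \<le> g" using that VW(2) by blast
      then have "{y\<in>V. y < A} \<subseteq> V \<inter> {..g}" by auto
      then show ?thesis using V_g[OF VW(1)] by blast
    qed
    have "V \<inter> W = {}" using V_g[OF VW(1)] VW(2) by blast
    then show ?thesis
      unfolding nested_weight_def
      by (simp only: prod.union_disjoint[OF finite finite] V W cong: prod.cong)
  qed
  have f: "?f (V \<union> W) = nested_weight V * (\<Sum>h\<in>F. ?a V h) * nested_weight W
      + nested_weight V * (nested_weight W * (weight g - of_nat (atom_dist (Sup W) g)))"
    if VW: "V \<in> ?A" "W \<in> ?B" for V W
  proof -
    have "(\<Sum>h\<in>F. ?a (V \<union> W) h) = (\<Sum>h\<in>F. ?a V h)"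
    proof (rule sum.cong[OF refl])
      fix h assume "h \<in> F"
      then have "h \<in> factors G p" "h \<noteq> g" using gF(2) insert.hyps(2) by auto
      then have "(V \<union> W) \<inter> {..h} = V \<inter> {..h}" by (rule VW_h[OF VW])
      then show "?a (V \<union> W) h = ?a V h" by (simp only:)
    qed
    then have s: "(\<Sum>h\<in>insert g F. ?a (V \<union> W) h)
        = (weight g - of_nat (atom_dist (Sup W) g)) + (\<Sum>h\<in>F. ?a V h)"
      using insert.hyps VW_g[OF VW] by simp
    show ?thesis
      unfolding weight_Un[OF VW] s by (simp only: distrib_left ac_simps)
  qed
  have "(\<Sum>W\<in>{W\<in>nested_sets G. W \<subseteq> (\<Union>h\<in>insert g F. {..h})}. ?f W)
      = (\<Sum>(V, W)\<in>?A \<times> ?B. ?f (V \<union> W))"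
  proof (rule sum.reindex_bij_witness[of _ "\<lambda>(V, W). V \<union> W" "\<lambda>W. (W \<inter> ?U, W \<inter> {..g})"])
    fix W assume W: "W \<in> {W\<in>nested_sets G. W \<subseteq> (\<Union>h\<in>insert g F. {..h})}"
    then have eq: "W \<inter> ?U \<union> W \<inter> {..g} = W" by blast
    show "(case (W \<inter> ?U, W \<inter> {..g}) of (V, W) \<Rightarrow> V \<union> W) = W" using eq by simp
    show "(W \<inter> ?U, W \<inter> {..g}) \<in> ?A \<times> ?B"
      using W nested_sets_subset[of W G] by auto
    show "(case (W \<inter> ?U, W \<inter> {..g}) of (V, W) \<Rightarrow> ?f (V \<union> W)) = ?f W"
      unfolding prod.case eq ..
  next
    fix VW assume "VW \<in> ?A \<times> ?B"
    then obtain V W where VW: "VW = (V, W)" "V \<in> ?A" "W \<in> ?B" by blast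
    have "(V \<union> W) \<inter> ?U = V" using W_U[OF VW(3)] VW(2) by blast
    then show "((case VW of (V, W) \<Rightarrow> V \<union> W) \<inter> ?U, (case VW of (V, W) \<Rightarrow> V \<union> W) \<inter> {..g}) = VW"
      using VW_g[OF VW(2,3)] by (simp only: VW(1) prod.case)
    show "(case VW of (V, W) \<Rightarrow> V \<union> W) \<in> {W\<in>nested_sets G. W \<subseteq> (\<Union>h\<in>insert g F. {..h})}"
      using VW_nested[OF VW(2,3)] VW by auto
  qed
  also have "\<dots> = (\<Sum>V\<in>?A. \<Sum>W\<in>?B. ?f (V \<union> W))"
    by (rule sum.cartesian_product[symmetric])
  also have "\<dots> = (\<Sum>V\<in>?A. \<Sum>W\<in>?B. nested_weight V * (\<Sum>h\<in>F. ?a V h) * nested_weight W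
      + nested_weight V * (nested_weight W * (weight g - of_nat (atom_dist (Sup W) g))))"
    by (intro sum.cong refl f)
  also have "\<dots> = (\<Sum>V\<in>?A. nested_weight V * (\<Sum>h\<in>F. ?a V h)) * (\<Sum>W\<in>?B. nested_weight W)
      + (\<Sum>V\<in>?A. nested_weight V) * (\<Sum>W\<in>?B. nested_weight W * (weight g - of_nat (atom_dist (Sup W) g)))"
    by (simp only: sum.distrib sum_product)
  also have "\<dots> = 0"
    using insert.IH[OF gF(2)] sum_nested_below_member[OF gG] by simp
  finally show ?case .
qed

text \<open>Weight and distance are additive over the factors of \<open>x\<close>, so the bracket
  for \<open>x\<close> is the sum of those for its factors. At \<open>bot\<close> weight and
  distance are both 0.\<close>

lemma sum_nested_below:
  "(\<Sum>W\<in>{W\<in>nested_sets G. W \<subseteq> {..x}}. nested_weight W * (weight x - of_nat (atom_dist (Sup W) x))) = 0"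
proof (cases "x = bot")
  case True
  have "weight x - of_nat (atom_dist (Sup W) x) = 0" if "W \<subseteq> {..x}" for W
  proof -
    have "Sup W \<le> bot" using that True by (intro Sup_least) auto
    then have Sup: "Sup W = bot" by (rule bot.extremum_uniqueI)
    show ?thesis unfolding Sup True using ranked by simp
  qed
  then show ?thesis by (intro sum.neutral) simp
next
  case False
  then interpret product_decomposition x "factors G x"
    by (rule building_set_product_decomposition[OF building])
  have "W \<subseteq> (\<Union>g\<in>factors G x. {..g}) \<longleftrightarrow> W \<subseteq> {..x}" if "W \<in> nested_sets G" for W
  proof -
    have "W \<subseteq> G" using that by (simp add: nested_sets_def)
    then have "\<exists>g\<in>factors G x. y \<le> g" if "y \<in> W" "y \<le> x" for y
      using below_factor[of y G x] that by blast
    moreover have "y \<le> x" if "g \<in> factors G x" "y \<le> g" for y g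
      using order_trans[OF that(2) factors_in(2)[OF that(1)]] .
    ultimately show ?thesis unfolding subset_iff UN_iff atMost_iff by metis
  qed
  then have sets: "{W\<in>nested_sets G. W \<subseteq> (\<Union>g\<in>factors G x. {..g})} = {W\<in>nested_sets G. W \<subseteq> {..x}}"
    by auto
  have "(\<Sum>g\<in>factors G x. weight g - of_nat (atom_dist (Sup (W \<inter> {..g})) g)) =
      weight x - of_nat (atom_dist (Sup W) x)" if "W \<in> {W\<in>nested_sets G. W \<subseteq> {..x}}" for W
  proof -
    let ?z = "\<lambda>g. Sup (W \<inter> {..g})"
    have W: "W \<subseteq> G" "W \<subseteq> {..x}" using that by (auto simp: nested_sets_def)
    have eq: "Sup (?z ` factors G x) = Sup W"
    proof (rule antisym)
      show "Sup (?z ` factors G x) \<le> Sup W" by (auto intro!: Sup_least intro: Sup_upper)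
      show "Sup W \<le> Sup (?z ` factors G x)"
      proof (rule Sup_least)
        fix y assume y: "y \<in> W"
        then obtain g where g: "g \<in> factors G x" "y \<le> g" using below_factor[of y G x] W by blast
        then have "y \<le> ?z g" using y by (intro Sup_upper) auto
        also have "\<dots> \<le> Sup (?z ` factors G x)" using g(1) by (intro Sup_upper) auto
        finally show "y \<le> Sup (?z ` factors G x)" .
      qed
    qed
    \<comment> \<open>The family \<open>?z\<close> lies below the factors and joins to
      \<open>Sup W\<close>, so it consists of the coordinates of \<open>Sup W\<close>.\<close>
    have "inf (Sup W) g = ?z g" if "g \<in> factors G x" for g
      using inf_Sup[of ?z g] that unfolding eq by (auto intro: Sup_least)
    moreover have "Sup W \<le> x" using W(2) by (intro Sup_least) auto
    ultimately have "atom_dist (Sup W) x = (\<Sum>g\<in>factors G x. atom_dist (?z g) g)"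
      by (simp add: atom_dist_eq_sum[OF atomic])
    then show ?thesis by (simp add: sum_subtractf weight_eq_sum[OF ranked])
  qed
  then show ?thesis
    using sum_nested_below_factors[OF False order_refl] unfolding sets by simp
qed

section \<open>Recursion for the partial sums with a given join\<close>

definition nested_sum :: "'a \<Rightarrow> rat poly fract" where
  "nested_sum x = (\<Sum>W\<in>{W\<in>nested_sets G. Sup W = x}. nested_weight W)"

lemma zeta_eq_sum_nested_sum: "zeta G = (\<Sum>x\<in>UNIV. nested_sum x)"
proof -
  have "zeta G = (\<Sum>W\<in>nested_sets G. nested_weight W)"
    by (simp only: zeta_eq nested_weight_def)
  then show ?thesis
    unfolding nested_sum_def using sum.group[of "nested_sets G" UNIV Sup nested_weight] by simp
qed

text \<open>The initial value: as \<open>bot\<close> is not in \<open>G\<close>, only the empty set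
  has join \<open>bot\<close>.\<close>

lemma nested_sum_bot: "nested_sum bot = 1"
proof -
  have "{W\<in>nested_sets G. Sup W = bot} = {{}}"
  proof (intro equalityI subsetI)
    fix W assume W: "W \<in> {W\<in>nested_sets G. Sup W = bot}"
    then have "Sup W = bot" by blast
    then have "y = bot" if "y \<in> W" for y
      using Sup_upper[OF that] by (metis bot.extremum_uniqueI)
    moreover have "bot \<notin> W" using W bot_notin by (auto simp: nested_sets_def)
    ultimately show "W \<in> {{}}" by blast
  qed (auto simp: nested_sets_def)
  then show ?thesis by (simp add: nested_sum_def nested_weight_def)
qed

text \<open>Group \<open>sum_nested_below\<close> by the joins of the nested sets and solve for the
  term at \<open>x\<close>, where the distance is 0. Apart from the smaller values of
  \<open>nested_sum\<close>, the right side refers only to the lattice.\<close>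

lemma nested_sum_recursion:
  assumes "x \<noteq> bot"
  shows "nested_sum x = - (\<Sum>y\<in>{..<x}. nested_sum y * (weight x - of_nat (atom_dist y x))) / weight x"
proof -
  let ?N = "{W\<in>nested_sets G. W \<subseteq> {..x}}"
  let ?w = "\<lambda>y. weight x - of_nat (atom_dist y x) :: rat poly fract"
  have "0 = (\<Sum>y\<in>{..x}. \<Sum>W\<in>{W\<in>?N. Sup W = y}. nested_weight W * ?w (Sup W))"
    unfolding sum_nested_below[of x, symmetric]
    by (rule sum.group[symmetric]) (auto intro: Sup_least)
  also have "\<dots> = (\<Sum>y\<in>{..x}. nested_sum y * ?w y)"
  proof (rule sum.cong[OF refl])
    fix y assume "y \<in> {..x}"
    then have "{W\<in>?N. Sup W = y} = {W\<in>nested_sets G. Sup W = y}"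
      by (auto intro: order_trans[OF Sup_upper])
    then have "(\<Sum>W\<in>{W\<in>?N. Sup W = y}. nested_weight W * ?w (Sup W))
        = (\<Sum>W\<in>{W\<in>nested_sets G. Sup W = y}. nested_weight W * ?w y)"
      by (intro sum.cong) auto
    then show "(\<Sum>W\<in>{W\<in>?N. Sup W = y}. nested_weight W * ?w (Sup W)) = nested_sum y * ?w y"
      by (simp only: nested_sum_def sum_distrib_right)
  qed
  also have "{..x} = insert x {..<x}" by (auto simp: order_le_less)
  finally have "nested_sum x * weight x = - (\<Sum>y\<in>{..<x}. nested_sum y * ?w y)"
    by (simp add: eq_neg_iff_add_eq_0)
  moreover have "weight x \<noteq> 0" by (rule weight_not_0[OF atomic assms])
  ultimately show ?thesis by (rule nonzero_eq_divide_eq[THEN iffD2, rotated])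
qed

end

text \<open>Both functions start with the same value and obey the same recursion over strictly
  smaller elements.\<close>

lemma nested_sum_independent:
  assumes "building (G :: 'a::{finite, complete_lattice} set)" "building G'"
  shows "building.nested_sum G x = building.nested_sum G' x"
proof (induction "card {..<x}" arbitrary: x rule: less_induct)
  case less
  show ?case
  proof (cases "x = bot")
    case True
    then show ?thesis by (simp add: building.nested_sum_bot assms)
  next
    case False
    have "building.nested_sum G y = building.nested_sum G' y" if "y < x" for y
      using that by (intro less.hyps psubset_card_mono) auto
    then show ?thesis
      by (simp add: building.nested_sum_recursion[OF assms(1) False] building.nested_sum_recursion[OF assms(2) False])
  qed
qed

theorem theorem1:
  fixes G G' :: "'a::{finite, complete_lattice} set"
  assumes "ranked TYPE('a)" and "atomic TYPE('a)"
    and "building_set G" and "building_set G'"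
  shows "zeta G = zeta G'"
proof -
  have "building G" "building G'"
    using assms by (auto intro: building.intro)
  then show ?thesis
    by (simp add: building.zeta_eq_sum_nested_sum nested_sum_independent[of G G'])
qed

end
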